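(* Let $\mathbb{K}$ be the projective Fraïssé limit of the category $\mathcal{K}$. Then the canonical quotient of $\mathcal{K}$ is the universal Knaster continuum; that is, the relation $R^{\mathbb{K}}$ is an equivalence relation and the quotient space $\mathbb{K}/R^{\mathbb{K}}$ is homeomorphic to the universal Knaster continuum.
   Context: For an integer $n\ge 2$, $\langle n\rangle$ denotes the pointed finite linear graph with vertex set $\{0,\dots,n-1\}$, edge relation $(i,j)\in R \iff |i-j|\le 1$, and zero-vertex $0$; every pointed finite linear graph (finite path with loops at all vertices and a designated end vertex, the zero-vertex) is isomorphic to some $\langle n\rangle$. An epimorphism takes edges to edges, is surjective on vertices and edges, and preserves the zero-vertex. $\mathcal{K}$ is the category of pointed finite linear graphs whose morphisms are all epimorphisms $f:\langle n\rangle\to\langle m\rangle$ for which there exist $0=i_0<\cdots<i_k=n-1$ such that $f$ restricted to each $[i_j,i_{j+1}]$ is monotone (non-increasing or non-decreasing), $f(i_j)=m-1$ for $j$ odd and $f(i_j)=0$ for $j$ even. $\mathcal{K}^\omega$ is the category of topological pointed graphs $\mathbb{L}=\varprojlim(L_n,g_n^{n+1})$ with $L_n\in\mathcal{K}$ and $g_n^{n+1}:L_{n+1}\to L_n$ in $\mathcal{K}$, with the product topology (each $L_n$ discrete), relation $(x,y)\in R^{\mathbb{L}}\iff (x_n,y_n)\in R^{L_n}$ for all $n$, and point $c^{\mathbb{L}}=(c^{L_n})_n$, where $c^{L_n}$ is the zero-vertex. A map $\phi:\varprojlim(K_n,f_n^{n+1})\to\varprojlim(L_n,g_n^{n+1})$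 is a morphism of $\mathcal{K}^\omega$ if there are $i_1<i_2<\cdots$ and $\phi_n:K_{i_n}\to L_n$ in $\mathcal{K}$ such that $\pi_n\circ\phi=\phi_n\circ\pi_{i_n}$ for every $n$ (where $\pi_n$ are coordinate projections). Objects of $\mathcal{K}$ are viewed as objects of $\mathcal{K}^\omega$ (constant sequences). The projective Fraïssé limit $\mathbb{K}$ of $\mathcal{K}$ is the object of $\mathcal{K}^\omega$, unique up to isomorphism, such that (1) for each $A\in\mathcal{K}$ there is a morphism $\mathbb{K}\to A$; (2) for $A,B\in\mathcal{K}$ and morphisms $f:\mathbb{K}\to A$, $g:B\to A$ there is a morphism $h:\mathbb{K}\to B$ with $g\circ h=f$. If $R^{\mathbb{K}}$ is an equivalence relation, $\mathbb{K}/R^{\mathbb{K}}$ with the quotient topology is called the canonical quotient of $\mathcal{K}$. Let $I=[0,1]$. A Knaster continuum is a space $\varprojlim(I,T_n^{n+1})$ with each $T_n^{n+1}:I\to I$ a continuous open surjection fixing $0$. The universal Knaster continuum is the (unique up to homeomorphism) Knaster continuum which admits a continuous open surjection onto every Knaster continuum. *)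

theory Defs
  imports "HOL-Analysis.Analysis"
begin

section \<open>The category of pointed finite linear graphs\<close>

text \<open>
  The object \<open>\<langle>n\<rangle>\<close>, for \<open>n \<ge> 2\<close>, is represented by the number \<open>n\<close>; its zero-vertex is \<open>0\<close>.
  A map out of \<open>\<langle>n\<rangle>\<close> is a function \<open>nat \<Rightarrow> nat\<close>, of which only the values on
  \<open>lg_verts n\<close> are meaningful.
\<close>

definition lg_verts :: "nat \<Rightarrow> nat set" where
  "lg_verts n = {..<n}"

definition lg_edges :: "nat \<Rightarrow> (nat \<times> nat) set" where
  "lg_edges n = {(i, j) \<in> lg_verts n \<times> lg_verts n. \<bar>int i - int j\<bar> \<le> 1}"

definition lg_object :: "nat \<Rightarrow> bool" where
  "lg_object n \<longleftrightarrow> 2 \<le> n"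

text \<open>The second equation says both that edges go to edges and that every edge is hit.\<close>

definition lg_epimorphism :: "nat \<Rightarrow> nat \<Rightarrow> (nat \<Rightarrow> nat) \<Rightarrow> bool" where
  "lg_epimorphism n m f \<longleftrightarrow>
     f ` lg_verts n = lg_verts m \<and>
     map_prod f f ` lg_edges n = lg_edges m \<and>
     f 0 = 0"

definition lg_morphism :: "nat \<Rightarrow> nat \<Rightarrow> (nat \<Rightarrow> nat) \<Rightarrow> bool" where
  "lg_morphism n m f \<longleftrightarrow>
     lg_object n \<and> lg_object m \<and> lg_epimorphism n m f \<and>
     (\<exists>(k::nat) (i::nat \<Rightarrow> nat).
        strict_mono_on {..k} i \<and> i 0 = 0 \<and> i k = n - 1 \<and>
        (\<forall>j<k. mono_on {i j..i (Suc j)} f \<or> antimono_on {i j..i (Suc j)} f) \<and>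
        (\<forall>j\<le>k. f (i j) = (if odd j then m - 1 else 0)))"


section \<open>Inverse limits of sequences and quotient spaces\<close>

definition inv_limit_set :: "(nat \<Rightarrow> 'a set) \<Rightarrow> (nat \<Rightarrow> 'a \<Rightarrow> 'a) \<Rightarrow> (nat \<Rightarrow> 'a) set" where
  "inv_limit_set X f = {x. (\<forall>n. x n \<in> X n) \<and> (\<forall>n. f n (x (Suc n)) = x n)}"

definition inv_limit :: "(nat \<Rightarrow> 'a topology) \<Rightarrow> (nat \<Rightarrow> 'a \<Rightarrow> 'a) \<Rightarrow> (nat \<Rightarrow> 'a) topology" where
  "inv_limit X f =
     subtopology (product_topology X UNIV) (inv_limit_set (\<lambda>n. topspace (X n)) f)"

definition quotient_space :: "'a topology \<Rightarrow> ('a \<times> 'a) set \<Rightarrow> 'a set topology" where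
  "quotient_space X r =
     topology (\<lambda>U. U \<subseteq> topspace X // r \<and> openin X {x \<in> topspace X. r `` {x} \<in> U})"

lemma openin_quotient_space:
  "openin (quotient_space X r) U \<longleftrightarrow>
     U \<subseteq> topspace X // r \<and> openin X {x \<in> topspace X. r `` {x} \<in> U}"
proof -
  have "istopology (\<lambda>U. U \<subseteq> topspace X // r \<and> openin X {x \<in> topspace X. r `` {x} \<in> U})"
    unfolding istopology_def
  proof (intro conjI allI impI)
    fix S T
    assume S: "S \<subseteq> topspace X // r \<and> openin X {x \<in> topspace X. r `` {x} \<in> S}"
      and T: "T \<subseteq> topspace X // r \<and> openin X {x \<in> topspace X. r `` {x} \<in> T}"
    show "S \<inter> T \<subseteq> topspace X // r" using S by blast
    have "{x \<in> topspace X. r `` {x} \<in> S \<inter> T} =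
          {x \<in> topspace X. r `` {x} \<in> S} \<inter> {x \<in> topspace X. r `` {x} \<in> T}" by blast
    then show "openin X {x \<in> topspace X. r `` {x} \<in> S \<inter> T}"
      using S T by (simp only: openin_Int)
  next
    fix K
    assume K: "\<forall>U\<in>K. U \<subseteq> topspace X // r \<and> openin X {x \<in> topspace X. r `` {x} \<in> U}"
    show "\<Union>K \<subseteq> topspace X // r" using K by blast
    have "{x \<in> topspace X. r `` {x} \<in> \<Union>K} = (\<Union>U\<in>K. {x \<in> topspace X. r `` {x} \<in> U})" by blast
    then show "openin X {x \<in> topspace X. r `` {x} \<in> \<Union>K}"
      using K by (simp only: openin_clauses(3) openin_Union image_iff) (blast intro: openin_Union)
  qed
  then show ?thesis
    unfolding quotient_space_def by (simp add: topology_inverse')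
qed

lemma topspace_quotient_space: "topspace (quotient_space X r) = topspace X // r"
proof
  show "topspace (quotient_space X r) \<subseteq> topspace X // r"
    using openin_quotient_space openin_topspace by blast
  have "{x \<in> topspace X. r `` {x} \<in> topspace X // r} = topspace X"
    by (auto simp: quotient_def)
  then have "openin (quotient_space X r) (topspace X // r)"
    by (simp add: openin_quotient_space)
  then show "topspace X // r \<subseteq> topspace (quotient_space X r)"
    by (rule openin_subset)
qed

lemma quotient_map_quotient_space: "quotient_map X (quotient_space X r) (\<lambda>x. r `` {x})"
  by (auto simp: quotient_map_def openin_quotient_space topspace_quotient_space quotient_def)


section \<open>Topological pointed graphs as inverse limits\<close>

text \<open>
  An object is given by its defining inverse sequence: the graphs together with the bonding
  maps, where \<open>snd L n\<close> goes from the \<open>Suc n\<close>-th graph to the \<open>n\<close>-th.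
  The distinguished point of the limit is always the constant sequence \<open>0\<close>, so it is not recorded.
\<close>

type_synonym tg = "(nat \<Rightarrow> nat) \<times> (nat \<Rightarrow> nat \<Rightarrow> nat)"

definition tg_object :: "tg \<Rightarrow> bool" where
  "tg_object L \<longleftrightarrow> (\<forall>n. lg_object (fst L n)) \<and>
                   (\<forall>n. lg_morphism (fst L (Suc n)) (fst L n) (snd L n))"

definition tg_carrier :: "tg \<Rightarrow> (nat \<Rightarrow> nat) set" where
  "tg_carrier L = inv_limit_set (\<lambda>n. lg_verts (fst L n)) (snd L)"

definition tg_topology :: "tg \<Rightarrow> (nat \<Rightarrow> nat) topology" where
  "tg_topology L = inv_limit (\<lambda>n. discrete_topology (lg_verts (fst L n))) (snd L)"

definition tg_rel :: "tg \<Rightarrow> ((nat \<Rightarrow> nat) \<times> (nat \<Rightarrow> nat)) set" where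
  "tg_rel L = {(x, y) \<in> tg_carrier L \<times> tg_carrier L. \<forall>n. (x n, y n) \<in> lg_edges (fst L n)}"

definition tg_morphism :: "tg \<Rightarrow> tg \<Rightarrow> ((nat \<Rightarrow> nat) \<Rightarrow> (nat \<Rightarrow> nat)) \<Rightarrow> bool" where
  "tg_morphism K L \<phi> \<longleftrightarrow>
     tg_object K \<and> tg_object L \<and> \<phi> \<in> tg_carrier K \<rightarrow> tg_carrier L \<and>
     (\<exists>(i::nat \<Rightarrow> nat) (\<phi>n::nat \<Rightarrow> nat \<Rightarrow> nat).
        strict_mono i \<and>
        (\<forall>n. lg_morphism (fst K (i n)) (fst L n) (\<phi>n n)) \<and>
        (\<forall>n. \<forall>x\<in>tg_carrier K. \<phi> x n = \<phi>n n (x (i n))))"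

definition tg_const :: "nat \<Rightarrow> tg" where
  "tg_const A = ((\<lambda>n. A), (\<lambda>n x. x))"

definition projective_Fraisse_limit :: "tg \<Rightarrow> bool" where
  "projective_Fraisse_limit K \<longleftrightarrow>
     tg_object K \<and>
     (\<forall>A. lg_object A \<longrightarrow> (\<exists>f. tg_morphism K (tg_const A) f)) \<and>
     (\<forall>A B f g. lg_object A \<and> lg_object B \<and>
        tg_morphism K (tg_const A) f \<and> tg_morphism (tg_const B) (tg_const A) g \<longrightarrow>
        (\<exists>h. tg_morphism K (tg_const B) h \<and> (\<forall>x\<in>tg_carrier K. g (h x) = f x)))"


section \<open>Knaster continua\<close>

abbreviation unit_interval :: "real topology" where
  "unit_interval \<equiv> top_of_set {0..1}"

definition open_surjection :: "'a topology \<Rightarrow> 'b topology \<Rightarrow> ('a \<Rightarrow> 'b) \<Rightarrow> bool" where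
  "open_surjection X Y f \<longleftrightarrow>
     continuous_map X Y f \<and> open_map X Y f \<and> f ` topspace X = topspace Y"

definition Knaster_continuum :: "(nat \<Rightarrow> real) topology \<Rightarrow> bool" where
  "Knaster_continuum X \<longleftrightarrow>
     (\<exists>T :: nat \<Rightarrow> real \<Rightarrow> real.
        (\<forall>n. open_surjection unit_interval unit_interval (T n) \<and> T n 0 = 0) \<and>
        X = inv_limit (\<lambda>n. unit_interval) T)"

text \<open>This determines the space only up to homeomorphism.\<close>

definition universal_Knaster_continuum :: "(nat \<Rightarrow> real) topology \<Rightarrow> bool" where
  "universal_Knaster_continuum U \<longleftrightarrow>
     Knaster_continuum U \<and> (\<forall>X. Knaster_continuum X \<longrightarrow> (\<exists>f. open_surjection U X f))"

end

theory Submission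
  imports Defs
begin

text \<open>
  Represent the vertex \<open>v\<close> of \<open>\<langle>b\<rangle>\<close> by the interval \<open>[v/b, (v+1)/b]\<close>, so that two vertices are adjacent
  exactly if their intervals meet, and let \<open>tent d\<close> be the zigzag of \<open>I\<close> with \<open>d\<close> legs.  Dividing
  each interval of \<open>\<langle>b\<rangle>\<close> by \<open>d\<close> and subdividing further turns \<open>tent d\<close> into a morphism of
  \<open>\<K>\<close>, a discrete tent map.  A point of the inverse limit of a sequence of discrete tent maps is a thread
  of intervals, each of which is mapped into the previous one; as the intervals shrink faster than
  the tent maps expand, it singles out one point of the limit of the tent maps
  (\<open>tent_limit_eqI\<close>).  Two threads single out the same point if and only if they are
  related, so that the relation is the kernel of a continuous map of compact spaces onto the
  limit of the tent maps.

  That every projective Fraisse limit is of this form is a back and forth argument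
  (\<open>projective_Fraisse_limit_tent_sequence\<close>).  A morphism \<open>\<langle>n\<rangle> \<rightarrow> \<langle>b\<rangle>\<close> is a monotone path wound to
  and fro on \<open>\<langle>b\<rangle>\<close> (\<open>lg_morphismI\<close>, \<open>lg_morphismE\<close>).  Hence a discrete tent map with the same number
  of legs lifts along it, provided that the subdivision leaves enough time at each vertex
  (\<open>lg_morphism_refine_to_tent\<close>), and the extension property of the limit absorbs the lift.  On the
  way the degree may be multiplied at will, so that the \<open>j\<close>-th degree is made divisible by \<open>j + 1\<close>.

  The limit of tent maps with such degrees is universal.  A continuous open surjection of \<open>I\<close> which
  fixes \<open>0\<close> is a tent map up to a homeomorphism of its source, because an open map has no local extrema
  with values inside \<open>(0, 1)\<close> (\<open>open_surjection_tent_factor\<close>).  So every Knaster continuum is a limit of tent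
  maps, and by divisibility there are tent maps from the coordinates of the universal limit to the
  coordinates of any other which commute with the bonding maps.  A limit of open maps need not be
  open.  Here it is, since the situation is covered by solenoids: \<open>z \<mapsto> arccos (Re z) / \<pi>\<close> carries
  the power maps of the circle to tent maps, and the composite of the cover with the map in
  question is the quotient of a compact group by a group of homeomorphisms
  (\<open>solenoid_fibres_homogeneous\<close>, \<open>open_map_if_fibres_homogeneous\<close>).
\<close>

section \<open>Inverse limits and quotients of compact spaces\<close>

lemma inv_limit_setD:
  assumes "x \<in> inv_limit_set X f"
  shows "x n \<in> X n" "f n (x (Suc n)) = x n"
  using assms by (auto simp: inv_limit_set_def)

lemma topspace_inv_limit:
  "topspace (inv_limit X f) = inv_limit_set (\<lambda>n. topspace (X n)) f"
  by (auto simp: inv_limit_def inv_limit_set_def)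

lemma continuous_map_inv_limit_coord:
  "continuous_map (inv_limit X f) (X n) (\<lambda>x. x n)"
  unfolding inv_limit_def by (intro continuous_map_from_subtopology continuous_map_product_coordinates) simp

lemma continuous_map_into_inv_limit:
  assumes "\<And>n. continuous_map Z (X n) (\<lambda>z. g z n)"
    and "\<And>z n. z \<in> topspace Z \<Longrightarrow> f n (g z (Suc n)) = g z n"
  shows "continuous_map Z (inv_limit X f) g"
proof -
  have "g z n \<in> topspace (X n)" if "z \<in> topspace Z" for z n
    using assms(1)[of n] that by (auto simp: continuous_map_def)
  then show ?thesis
    unfolding inv_limit_def using assms
    by (auto simp: continuous_map_in_subtopology continuous_map_componentwise_UNIV inv_limit_set_def)
qed

lemma Hausdorff_space_inv_limit:
  assumes "\<And>n. Hausdorff_space (X n)"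
  shows "Hausdorff_space (inv_limit X f)"
  unfolding inv_limit_def
  by (intro Hausdorff_space_subtopology) (simp add: Hausdorff_space_product_topology assms)

lemma compact_space_inv_limit:
  assumes "\<And>n. compact_space (X n)" "\<And>n. Hausdorff_space (X n)"
    and "\<And>n. continuous_map (X (Suc n)) (X n) (f n)"
  shows "compact_space (inv_limit X f)"
proof -
  let ?P = "product_topology X UNIV"
  have cm: "continuous_map ?P (X n) (\<lambda>x. f n (x (Suc n)))" for n
    using continuous_map_compose[OF continuous_map_product_coordinates[of "Suc n" UNIV X] assms(3)[of n]]
    by (simp add: o_def)
  have "closedin ?P {x \<in> topspace ?P. f n (x (Suc n)) = x n}" for n
    by (rule closedin_continuous_maps_eq[OF assms(2) cm]) simp
  then have "closedin ?P (\<Inter>n. {x \<in> topspace ?P. f n (x (Suc n)) = x n})"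
    by (intro closedin_Inter) auto
  also have "(\<Inter>n. {x \<in> topspace ?P. f n (x (Suc n)) = x n}) = inv_limit_set (\<lambda>n. topspace (X n)) f"
    by (auto simp: inv_limit_set_def PiE_def)
  finally have cl: "closedin ?P (inv_limit_set (\<lambda>n. topspace (X n)) f)" .
  have "compact_space ?P"
    by (simp add: compact_space_product_topology assms(1))
  then show ?thesis
    unfolding inv_limit_def by (intro compact_space_subtopology closedin_compact_space cl)
qed

text \<open>Above the coordinate \<open>n\<close> the point is found by successive lifting, below it by pushing down.\<close>

lemma inv_limit_set_coord_surj:
  assumes "\<And>n. f n ` X (Suc n) = X n" "a \<in> X n"
  shows "\<exists>x \<in> inv_limit_set X f. x n = a"
  using assms
proof (induction n arbitrary: X f)
  case 0
  let ?P = "\<lambda>k v. v \<in> X k \<and> (k = 0 \<longrightarrow> v = a)"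
  have "\<exists>w. ?P (Suc k) w \<and> f k w = v" if "?P k v" for v k
  proof -
    have "v \<in> f k ` X (Suc k)" using that 0 by simp
    then show ?thesis by auto
  qed
  then obtain x where "\<And>k. ?P k (x k)" "\<And>k. f k (x (Suc k)) = x k"
    using dependent_nat_choice[of ?P "\<lambda>k v w. f k w = v"] 0(2) by blast
  then show ?case
    by (intro bexI[of _ x]) (auto simp: inv_limit_set_def)
next
  case (Suc n)
  have "\<exists>y \<in> inv_limit_set (\<lambda>k. X (Suc k)) (\<lambda>k. f (Suc k)). y n = a"
    by (rule Suc.IH) (use Suc.prems in auto)
  then obtain y where y: "y \<in> inv_limit_set (\<lambda>k. X (Suc k)) (\<lambda>k. f (Suc k))" "y n = a"
    by blast
  define x where "x = case_nat (f 0 (y 0)) y"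
  have "f 0 (y 0) \<in> X 0"
    using inv_limit_setD(1)[OF y(1), of 0] Suc.prems(1)[of 0] by blast
  then have "x \<in> inv_limit_set X f"
    using y(1) by (auto simp: inv_limit_set_def x_def split: nat.splits)
  moreover have "x (Suc n) = a"
    by (simp add: x_def y)
  ultimately show ?case
    by blast
qed

text \<open>
  This finds a point of a compact space whose coordinates are prescribed, once each single
  coordinate can be prescribed.
\<close>

lemma compact_space_nested_closed:
  fixes F :: "nat \<Rightarrow> 'a set"
  assumes "compact_space Z" "\<And>n. closedin Z (F n)" "\<And>n. F n \<noteq> {}" "\<And>n. F (Suc n) \<subseteq> F n"
  obtains z where "z \<in> topspace Z" "\<And>n. z \<in> F n"
proof -
  have "decseq F"
    by (simp add: decseq_Suc_iff assms(4))
  then have "(\<Inter>n. F n) \<noteq> {}"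
    by (intro compact_space_imp_nest[OF assms(1)] assms(2,3))
  then obtain z where "\<And>n. z \<in> F n"
    by blast
  then show thesis
    using that closedin_subset[OF assms(2)] by blast
qed

text \<open>
  Under the hypothesis the saturation of an open set \<open>O\<close> is open: if \<open>q x = q a\<close> with \<open>a \<in> O\<close>, then
  a map \<open>g\<close> with \<open>g x = a\<close> and \<open>q \<circ> g = q\<close> pulls \<open>O\<close> back to a neighbourhood of \<open>x\<close> inside the
  saturation.  As \<open>q\<close> is a quotient map by compactness, it is then open.  This is the argument
  which shows that a continuous epimorphism of compact groups is open.
\<close>

lemma open_map_if_fibres_homogeneous:
  assumes "compact_space Z" "Hausdorff_space Y" "continuous_map Z Y q"
    and surj: "q ` topspace Z = topspace Y"
    and hom: "\<And>x a. \<lbrakk>x \<in> topspace Z; a \<in> topspace Z; q x = q a\<rbrakk> \<Longrightarrow>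
       \<exists>g. continuous_map Z Z g \<and> g x = a \<and> (\<forall>y\<in>topspace Z. q (g y) = q y)"
  shows "open_map Z Y q"
  unfolding open_map_def
proof (intro allI impI)
  fix A assume A: "openin Z A"
  have q: "quotient_map Z Y q"
    by (intro T1_Spaces.continuous_imp_quotient_map assms)
  have "openin Z {x \<in> topspace Z. q x \<in> q ` A}"
  proof (subst openin_subopen, intro ballI)
    fix x assume "x \<in> {x \<in> topspace Z. q x \<in> q ` A}"
    then obtain a where x: "x \<in> topspace Z" and a: "a \<in> A" "q x = q a" by blast
    then obtain g where g: "continuous_map Z Z g" "g x = a" "\<forall>y\<in>topspace Z. q (g y) = q y"
      using hom openin_subset[OF A] by (metis subsetD)
    show "\<exists>T. openin Z T \<and> x \<in> T \<and> T \<subseteq> {x \<in> topspace Z. q x \<in> q ` A}"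
    proof (intro exI conjI)
      show "openin Z {y \<in> topspace Z. g y \<in> A}"
        by (rule openin_continuous_map_preimage[OF g(1) A])
      show "x \<in> {y \<in> topspace Z. g y \<in> A}" using x a g by auto
      show "{y \<in> topspace Z. g y \<in> A} \<subseteq> {x \<in> topspace Z. q x \<in> q ` A}"
        using g(3) by (auto simp: image_iff) metis
    qed
  qed
  moreover have "q ` A \<subseteq> topspace Y"
    using surj openin_subset[OF A] by blast
  ultimately show "openin Y (q ` A)"
    using q by (simp add: quotient_map_def)
qed

text \<open>An open set of \<open>U\<close> is the image of its preimage in \<open>Z\<close>.\<close>

lemma open_map_cancel_right:
  assumes "continuous_map Z U s" "s ` topspace Z = topspace U"
    and "open_map Z X q" "\<And>z. z \<in> topspace Z \<Longrightarrow> \<phi> (s z) = q z"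
  shows "open_map U X \<phi>"
  unfolding open_map_def
proof (intro allI impI)
  fix A assume A: "openin U A"
  let ?B = "{z \<in> topspace Z. s z \<in> A}"
  have B: "openin Z ?B"
    by (rule openin_continuous_map_preimage[OF assms(1) A])
  have "A \<subseteq> topspace U" using A openin_subset by blast
  then have "A = s ` ?B" using assms(2) by (auto simp: image_iff subset_iff)
  then have "\<phi> ` A = (\<lambda>z. \<phi> (s z)) ` ?B" by (metis image_image)
  also have "\<dots> = q ` ?B" by (rule image_cong) (use assms(4) in auto)
  finally show "openin X (\<phi> ` A)"
    using B assms(3) by (simp add: open_map_def)
qed

lemma quotient_space_homeomorphic:
  assumes "compact_space Z" "Hausdorff_space Y" "continuous_map Z Y q" "q ` topspace Z = topspace Y"
    and "equiv (topspace Z) r"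
    and ker: "\<And>x y. \<lbrakk>x \<in> topspace Z; y \<in> topspace Z\<rbrakk> \<Longrightarrow> (x, y) \<in> r \<longleftrightarrow> q x = q y"
  shows "quotient_space Z r homeomorphic_space Y"
proof -
  have q: "quotient_map Z Y q"
    by (intro T1_Spaces.continuous_imp_quotient_map assms)
  let ?p = "\<lambda>x. r `` {x}"
  have p: "quotient_map Z (quotient_space Z r) ?p"
    by (rule quotient_map_quotient_space)
  have fib: "?p x = ?p y \<longleftrightarrow> q x = q y" if "x \<in> topspace Z" "y \<in> topspace Z" for x y
    using that ker eq_equiv_class_iff[OF assms(5)] by simp
  obtain g where g: "continuous_map (quotient_space Z r) Y g"
    "g ` topspace (quotient_space Z r) = q ` topspace Z" "\<And>x. x \<in> topspace Z \<Longrightarrow> g (?p x) = q x"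
    using quotient_map_lift_exists[OF p assms(3)] fib by metis
  have "quotient_map Z Y (g \<circ> ?p)"
    by (rule quotient_map_eq[OF q]) (simp add: g)
  then have "quotient_map (quotient_space Z r) Y g"
    by (simp add: quotient_map_compose_eq[OF p])
  moreover have "inj_on g (topspace (quotient_space Z r))"
    using fib g(3) by (auto simp: inj_on_def topspace_quotient_space quotient_def)
  ultimately have "homeomorphic_map (quotient_space Z r) Y g"
    by (simp add: homeomorphic_map_def)
  then show ?thesis
    by (rule homeomorphic_map_imp_homeomorphic_space)
qed

section \<open>Tent maps and the unit circle\<close>

text \<open>
  The zigzag with \<open>d\<close> legs of slope \<open>\<plusminus> d\<close>, that is, the distance of \<open>d * x\<close> from the set of even
  integers.  In this form it is, up to the coordinate change \<open>x \<mapsto> cos (\<pi> x)\<close>, the Chebyshev polynomial of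
  degree \<open>d\<close>, and is covered by the power map of the circle.
\<close>

definition tent :: "nat \<Rightarrow> real \<Rightarrow> real" where
  "tent d x = arccos (cos (real d * pi * x)) / pi"

abbreviation unit_circle :: "complex topology" where
  "unit_circle \<equiv> top_of_set (sphere 0 1)"

text \<open>The quotient of the circle by complex conjugation.\<close>

definition circle_fold :: "complex \<Rightarrow> real" where
  "circle_fold w = arccos (Re w) / pi"

text \<open>With \<open>tent_cases\<close> this describes \<open>tent\<close> without trigonometric functions.\<close>

lemma tent_eqI:
  assumes "0 \<le> y" "y \<le> 1" and "real d * x = 2 * of_int c + y \<or> real d * x = 2 * of_int c - y"
  shows "tent d x = y"
proof -
  have "cos (real d * pi * x) = cos (pi * y)"
  proof -
    have "real d * pi * x = 2 * pi * of_int c + pi * y \<or> real d * pi * x = 2 * pi * of_int c - pi * y"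
      using assms(3) by (metis (no_types, opaque_lifting) distrib_left right_diff_distrib mult.assoc mult.commute)
    then show ?thesis
      by (auto simp: cos_add cos_diff)
  qed
  moreover have "arccos (cos (pi * y)) = pi * y"
    using assms by (intro arccos_cos) (auto simp: mult_le_cancel_left1)
  ultimately show ?thesis
    by (simp add: tent_def)
qed

lemma tent_bounds: "0 \<le> tent d x" "tent d x \<le> 1"
  by (auto simp: tent_def arccos_lbound arccos_ubound divide_simps)

lemma tent_cases:
  obtains c :: int where "real d * x = 2 * of_int c + tent d x \<or> real d * x = 2 * of_int c - tent d x"
proof -
  define t where "t = real d * x"
  define c where "c = \<lfloor>t / 2 + 1 / 2\<rfloor>"
  define y where "y = \<bar>t - 2 * of_int c\<bar>"
  have "of_int c \<le> t / 2 + 1 / 2" "t / 2 + 1 / 2 < of_int c + 1"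
    unfolding c_def by linarith+
  then have "y \<le> 1" "0 \<le> y" unfolding y_def by linarith+
  moreover have c: "t = 2 * of_int c + y \<or> t = 2 * of_int c - y"
    unfolding y_def by linarith
  ultimately have "tent d x = y"
    by (intro tent_eqI[of _ _ _ c]) (auto simp: t_def)
  with c that show thesis unfolding t_def by blast
qed

lemma tent_zero [simp]: "tent d 0 = 0"
  by (simp add: tent_def)

lemma tent_one [simp]: "0 \<le> x \<Longrightarrow> x \<le> 1 \<Longrightarrow> tent (Suc 0) x = x"
  by (rule tent_eqI[of _ _ _ 0]) auto

lemma tent_tent: "tent d (tent e x) = tent (d * e) x"
proof -
  obtain c where c: "real e * x = 2 * of_int c + tent e x \<or> real e * x = 2 * of_int c - tent e x"
    using tent_cases by blast
  obtain c' where c': "real d * tent e x = 2 * of_int c' + tent d (tent e x) \<or>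
    real d * tent e x = 2 * of_int c' - tent d (tent e x)"
    using tent_cases by blast
  define y where "y = tent e x"
  define z where "z = tent d y"
  from c have "real (d * e) * x = 2 * of_int (int d * c) + real d * y \<or>
      real (d * e) * x = 2 * of_int (int d * c) - real d * y"
    unfolding y_def[symmetric]
    by (metis (no_types, opaque_lifting) distrib_left right_diff_distrib mult.assoc mult.commute
        of_int_mult of_int_of_nat_eq of_nat_mult)
  moreover have "real d * y = 2 * of_int c' + z \<or> real d * y = 2 * of_int c' - z"
    using c' by (simp add: y_def z_def)
  ultimately have "real (d * e) * x = 2 * of_int (int d * c + c') + z \<or>
      real (d * e) * x = 2 * of_int (int d * c + c') - z \<or>
      real (d * e) * x = 2 * of_int (int d * c - c') + z \<or>
      real (d * e) * x = 2 * of_int (int d * c - c') - z"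
    unfolding of_int_add of_int_diff by argo
  then have "tent (d * e) x = z"
    using tent_eqI[of z "d * e" x] tent_bounds[of d y] z_def by blast
  then show ?thesis by (simp add: y_def z_def)
qed

lemma tent_Lipschitz: "\<bar>tent d x - tent d y\<bar> \<le> real d * \<bar>x - y\<bar>"
proof -
  obtain c where c: "real d * x = 2 * of_int c + tent d x \<or> real d * x = 2 * of_int c - tent d x"
    using tent_cases by blast
  obtain c' where c': "real d * y = 2 * of_int c' + tent d y \<or> real d * y = 2 * of_int c' - tent d y"
    using tent_cases by blast
  have b: "0 \<le> tent d x" "tent d x \<le> 1" "0 \<le> tent d y" "tent d y \<le> 1"
    using tent_bounds by blast+
  have "real d * \<bar>x - y\<bar> = \<bar>real d * x - real d * y\<bar>"
    by (simp add: abs_mult flip: right_diff_distrib)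
  moreover have "c \<le> c' - 1 \<or> c = c' \<or> c' \<le> c - 1" by linarith
  then have "real_of_int c \<le> of_int c' - 1 \<or> real_of_int c = of_int c' \<or> real_of_int c' \<le> of_int c - 1"
    by linarith
  ultimately show ?thesis using c c' b by (smt (verit))
qed

lemma continuous_map_tent: "continuous_map unit_interval unit_interval (tent d)"
proof -
  have "continuous_on UNIV (tent d)"
    unfolding tent_def[abs_def] by (intro continuous_intros) auto
  then have "continuous_on {0..1} (tent d)"
    by (rule continuous_on_subset) simp
  then show ?thesis
    using tent_bounds by auto
qed

lemma circle_fold_bounds:
  assumes "w \<in> sphere 0 1" shows "circle_fold w \<in> {0..1}"
proof -
  have "\<bar>Re w\<bar> \<le> 1" using assms abs_Re_le_cmod[of w] by simp
  then show ?thesis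
    by (auto simp: circle_fold_def arccos_lbound arccos_ubound divide_simps abs_le_iff)
qed

lemma continuous_map_circle_fold: "continuous_map unit_circle unit_interval circle_fold"
proof -
  have "\<bar>Re w\<bar> \<le> 1" if "w \<in> sphere 0 1" for w
    using that abs_Re_le_cmod[of w] by simp
  then have "continuous_on (sphere 0 1) circle_fold"
    unfolding circle_fold_def[abs_def]
    by (intro continuous_intros) (auto simp: abs_le_iff intro: minus_le_iff[THEN iffD1])
  then show ?thesis
    using circle_fold_bounds by auto
qed

lemma circle_fold_cis: "circle_fold (cis t) = tent (Suc 0) (t / pi)"
  by (simp add: circle_fold_def tent_def)

lemma circle_fold_power:
  assumes "w \<in> sphere 0 1" shows "circle_fold (w ^ d) = tent d (circle_fold w)"
proof -
  have "w = cis (Arg w)"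
    using assms rcis_cmod_Arg[of w] by (simp add: rcis_def)
  then obtain t where w: "w = cis (pi * t)"
    by (metis nonzero_mult_div_cancel_left pi_neq_zero times_divide_eq_right)
  have "circle_fold (w ^ d) = tent d t"
    by (simp add: w Complex.DeMoivre circle_fold_cis) (simp add: tent_def mult_ac)
  also have "\<dots> = tent d (circle_fold w)"
    by (simp add: w circle_fold_cis tent_tent)
  finally show ?thesis .
qed

lemma circle_fold_eqD:
  assumes "w \<in> sphere 0 1" "v \<in> sphere 0 1" "circle_fold w = circle_fold v"
  shows "w = v \<or> w = cnj v"
proof -
  have "arccos (Re w) = arccos (Re v)"
    using assms(3) by (simp add: circle_fold_def)
  then have "Re w = Re v"
    using assms(1,2) abs_Re_le_cmod[of w] abs_Re_le_cmod[of v] by (simp add: arccos_eq_iff)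
  moreover have "(Re w)\<^sup>2 + (Im w)\<^sup>2 = 1" "(Re v)\<^sup>2 + (Im v)\<^sup>2 = 1"
    using assms(1,2) by (simp_all flip: cmod_power2)
  ultimately have "(Im w)\<^sup>2 = (Im v)\<^sup>2" by simp
  then show ?thesis
    using \<open>Re w = Re v\<close> by (auto simp: power2_eq_iff complex_eq_iff)
qed

lemma circle_fold_cnj [simp]: "circle_fold (cnj w) = circle_fold w"
  by (simp add: circle_fold_def)

lemma circle_fold_cis_pi [simp]: "0 \<le> x \<Longrightarrow> x \<le> 1 \<Longrightarrow> circle_fold (cis (pi * x)) = x"
  using circle_fold_cis[of "pi * x"] by simp

lemma circle_fold_onto: "circle_fold ` sphere 0 1 = {0..1}"
proof
  show "circle_fold ` sphere 0 1 \<subseteq> {0..1}" using circle_fold_bounds by blast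
  show "{0..1} \<subseteq> circle_fold ` sphere 0 1"
  proof
    fix x :: real assume "x \<in> {0..1}"
    then show "x \<in> circle_fold ` sphere 0 1"
      by (intro image_eqI[of _ _ "cis (pi * x)"]) auto
  qed
qed

lemma tent_onto:
  assumes "1 \<le> d" shows "tent d ` {0..1} = {0..1}"
proof
  show "tent d ` {0..1} \<subseteq> {0..1}" using tent_bounds by auto
  show "{0..1} \<subseteq> tent d ` {0..1}"
  proof
    fix x :: real assume x: "x \<in> {0..1}"
    then have "x / d \<in> {0..1}" using assms by (auto simp: field_simps)
    moreover have "tent d (x / d) = x"
      by (rule tent_eqI[of _ _ _ 0]) (use assms x in auto)
    ultimately show "x \<in> tent d ` {0..1}" by (metis imageI)
  qed
qed

text \<open>
  The fibres of \<open>w \<mapsto> circle_fold (w ^ d)\<close> are the orbits of the group generated by complex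
  conjugation and the rotations by \<open>d\<close>-th roots of unity.
\<close>

lemma open_surjection_tent:
  assumes "1 \<le> d" shows "open_surjection unit_interval unit_interval (tent d)"
proof -
  let ?q = "\<lambda>w. tent d (circle_fold w)"
  have q: "continuous_map unit_circle unit_interval ?q"
    using continuous_map_compose[OF continuous_map_circle_fold continuous_map_tent] by (simp add: o_def)
  have "open_map unit_circle unit_interval ?q"
  proof (rule open_map_if_fibres_homogeneous[OF _ _ q])
    show "compact_space unit_circle" by (simp add: compact_space_subtopology)
    show "?q ` topspace unit_circle = topspace unit_interval"
    proof -
      have "?q ` sphere 0 1 = tent d ` circle_fold ` sphere 0 1" by (simp only: image_image)
      then show ?thesis using circle_fold_onto tent_onto[OF assms] by simp
    qed
    fix x a assume xa: "x \<in> topspace unit_circle" "a \<in> topspace unit_circle" "?q x = ?q a"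
    then have x: "x \<in> sphere 0 1" and a: "a \<in> sphere 0 1" by auto
    then have nz: "x \<noteq> 0" "a \<noteq> 0" by auto
    have "circle_fold (x ^ d) = circle_fold (a ^ d)"
      using xa circle_fold_power x a by simp
    then have "x ^ d = a ^ d \<or> x ^ d = cnj (a ^ d)"
      by (intro circle_fold_eqD) (use x a in \<open>auto simp: norm_power\<close>)
    then consider "x ^ d = a ^ d" | "cnj x ^ d = a ^ d" by (metis complex_cnj_cnj complex_cnj_power)
    then show "\<exists>g. continuous_map unit_circle unit_circle g \<and> g x = a \<and>
        (\<forall>y\<in>topspace unit_circle. ?q (g y) = ?q y)"
    proof cases
      case 1
      then show ?thesis using x a nz
        by (intro exI[of _ "\<lambda>v. v * (a / x)"])
          (auto simp: norm_mult norm_divide power_mult_distrib power_divide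
             intro!: continuous_intros simp flip: circle_fold_power)
    next
      case 2
      then show ?thesis using x a nz
        by (intro exI[of _ "\<lambda>v. cnj v * (a / cnj x)"])
          (auto simp: norm_mult norm_divide power_mult_distrib power_divide
             intro!: continuous_intros simp flip: circle_fold_power complex_cnj_power)
    qed
  qed (simp add: Hausdorff_space_subtopology)
  then have "open_map unit_interval unit_interval (tent d)"
    using open_map_cancel_right[OF continuous_map_circle_fold, of unit_interval ?q "tent d"]
      circle_fold_onto by simp
  then show ?thesis
    using continuous_map_tent tent_onto[OF assms] by (simp add: open_surjection_def)
qed

section \<open>Open maps of the interval\<close>

lemma openin_unit_interval_Max:
  fixes V :: "real set"
  assumes "openin unit_interval V" "v \<in> V" "\<And>y. y \<in> V \<Longrightarrow> y \<le> v"
  shows "v = 1"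
proof (rule ccontr)
  assume "v \<noteq> 1"
  obtain e where e: "e > 0" "ball v e \<inter> {0..1} \<subseteq> V"
    using assms(1,2) openin_contains_ball by metis
  have "v \<in> {0..1}" using assms(1,2) openin_imp_subset by blast
  then have "min 1 (v + e / 2) \<in> ball v e \<inter> {0..1}"
    using e(1) \<open>v \<noteq> 1\<close> by (auto simp: dist_real_def min_def)
  then show False
    using e assms(3)[of "min 1 (v + e / 2)"] \<open>v \<noteq> 1\<close> \<open>v \<in> {0..1}\<close> by auto
qed

lemma openin_unit_interval_Min:
  fixes V :: "real set"
  assumes "openin unit_interval V" "v \<in> V" "\<And>y. y \<in> V \<Longrightarrow> v \<le> y"
  shows "v = 0"
proof (rule ccontr)
  assume "v \<noteq> 0"
  obtain e where e: "e > 0" "ball v e \<inter> {0..1} \<subseteq> V"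
    using assms(1,2) openin_contains_ball by metis
  have "v \<in> {0..1}" using assms(1,2) openin_imp_subset by blast
  then have "max 0 (v - e / 2) \<in> ball v e \<inter> {0..1}"
    using e(1) \<open>v \<noteq> 0\<close> by (auto simp: dist_real_def max_def)
  then show False
    using e assms(3)[of "max 0 (v - e / 2)"] \<open>v \<noteq> 0\<close> \<open>v \<in> {0..1}\<close> by auto
qed

context
  fixes f :: "real \<Rightarrow> real"
  assumes cont: "continuous_on {0..1} f" and range: "\<And>x. x \<in> {0..1} \<Longrightarrow> f x \<in> {0..1}"
    and opn: "open_map unit_interval unit_interval f"
begin

text \<open>
  The image of a relatively open set is relatively open in \<open>{0..1}\<close>, and so has no largest element
  but \<open>1\<close> and no smallest element but \<open>0\<close>.
\<close>

lemma open_map_interior_max: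
  assumes "openin unit_interval W" "c \<in> W" "\<And>x. x \<in> W \<Longrightarrow> f x \<le> f c"
  shows "f c = 1"
proof (rule openin_unit_interval_Max[of "f ` W"])
  show "openin unit_interval (f ` W)" using opn assms(1) by (simp add: open_map_def)
qed (use assms in auto)

lemma open_map_interior_min:
  assumes "openin unit_interval W" "c \<in> W" "\<And>x. x \<in> W \<Longrightarrow> f c \<le> f x"
  shows "f c = 0"
proof (rule openin_unit_interval_Min[of "f ` W"])
  show "openin unit_interval (f ` W)" using opn assms(1) by (simp add: open_map_def)
qed (use assms in auto)

lemma openin_unit_interval_Ioo: "0 \<le> s \<Longrightarrow> t \<le> 1 \<Longrightarrow> openin unit_interval {s<..<t::real}"
  by (rule open_subset) auto

text \<open>
  If a maximum over \<open>{s..t}\<close> is attained in the interior, then its value is \<open>1\<close>; otherwise it is attained at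
  an end.
\<close>

lemma equal_values_max:
  assumes "0 \<le> s" "s < t" "t \<le> 1" "f s = f t"
  shows "(\<exists>r\<in>{s<..<t}. f r = 1) \<or> (\<forall>x\<in>{s..t}. f x \<le> f s)"
proof -
  have "continuous_on {s..t} f"
    by (rule continuous_on_subset[OF cont]) (use assms in auto)
  then obtain m where m: "m \<in> {s..t}" "\<And>x. x \<in> {s..t} \<Longrightarrow> f x \<le> f m"
    using continuous_attains_sup[of "{s..t}" f] assms by auto
  show ?thesis
  proof (cases "m \<in> {s<..<t}")
    case True
    then have "f m = 1"
      using open_map_interior_max[OF openin_unit_interval_Ioo, of s t m] assms m by auto
    with True show ?thesis by blast
  next
    case False
    then have "m = s \<or> m = t" using m by auto
    then show ?thesis using m assms by auto
  qed
qed

lemma equal_values_min: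
  assumes "0 \<le> s" "s < t" "t \<le> 1" "f s = f t"
  shows "(\<exists>r\<in>{s<..<t}. f r = 0) \<or> (\<forall>x\<in>{s..t}. f s \<le> f x)"
proof -
  have "continuous_on {s..t} f"
    by (rule continuous_on_subset[OF cont]) (use assms in auto)
  then obtain m where m: "m \<in> {s..t}" "\<And>x. x \<in> {s..t} \<Longrightarrow> f m \<le> f x"
    using continuous_attains_inf[of "{s..t}" f] assms by auto
  show ?thesis
  proof (cases "m \<in> {s<..<t}")
    case True
    then have "f m = 0"
      using open_map_interior_min[OF openin_unit_interval_Ioo, of s t m] assms m by auto
    with True show ?thesis by blast
  next
    case False
    then have "m = s \<or> m = t" using m by auto
    then show ?thesis using m assms by auto
  qed
qed

lemma not_locally_constant:
  assumes "0 \<le> s" "s < t" "t \<le> 1" "\<And>x. x \<in> {s..t} \<Longrightarrow> f x = v"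
  shows False
proof -
  let ?c = "(s + t) / 2"
  have "f ?c = 1"
    using assms by (intro open_map_interior_max[OF openin_unit_interval_Ioo[of s t]]) auto
  moreover have "f ?c = 0"
    using assms by (intro open_map_interior_min[OF openin_unit_interval_Ioo[of s t]]) auto
  ultimately show False by simp
qed

lemma extreme_between_equal_values:
  assumes "0 \<le> s" "s < t" "t \<le> 1" "f s = f t"
  shows "\<exists>r\<in>{s<..<t}. f r \<in> {0, 1}"
proof (rule ccontr)
  assume "\<not> ?thesis"
  then have "\<forall>x\<in>{s..t}. f x = f s"
    using equal_values_max[OF assms] equal_values_min[OF assms] by force
  then show False using not_locally_constant assms by blast
qed

lemma extremes_alternate:
  assumes "0 \<le> s" "s < t" "t \<le> 1" "f s = f t" "f s \<in> {0, 1}"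
  shows "\<exists>r\<in>{s<..<t}. f r = 1 - f s"
proof (rule ccontr)
  assume *: "\<not> ?thesis"
  have rg: "x \<in> {s..t} \<Longrightarrow> f x \<in> {0..1}" for x using range assms by auto
  have "\<forall>x\<in>{s..t}. f x = f s"
  proof (cases "f s = 0")
    case True
    then show ?thesis using * equal_values_max[OF assms(1-4)] rg by force
  next
    case False
    then show ?thesis using * equal_values_min[OF assms(1-4)] rg assms(5) by force
  qed
  then show False using not_locally_constant assms by blast
qed

text \<open>
  Near an accumulation point of the extremes the function would, by alternation, take both values
  \<open>0\<close> and \<open>1\<close>, against continuity.
\<close>

lemma finite_extremes: "finite {x \<in> {0..1}. f x \<in> {0, 1}}" (is "finite ?E")
proof (rule ccontr)
  assume "infinite ?E"
  then obtain p where p: "p \<in> {0..1}" "p islimpt ?E"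
    using compact_eq_Bolzano_Weierstrass[of "{0..1::real}", THEN iffD1, rule_format, of ?E] by blast
  have "\<exists>\<delta>>0. \<forall>x\<in>{0..1}. dist x p < \<delta> \<longrightarrow> dist (f x) (f p) < 1 / 2"
    by (rule cont[unfolded continuous_on_iff, rule_format, OF p(1)]) simp
  then obtain \<delta> where \<delta>: "\<delta> > 0" "\<And>x. x \<in> {0..1} \<Longrightarrow> dist x p < \<delta> \<Longrightarrow> dist (f x) (f p) < 1 / 2"
    by blast
  have inf: "infinite (?E \<inter> ball p \<delta>)"
    using p(2) \<delta>(1) by (simp add: islimpt_eq_infinite_ball)
  then obtain s where s: "s \<in> ?E \<inter> ball p \<delta>"
    using infinite_imp_nonempty by blast
  have "infinite (?E \<inter> ball p \<delta> - {s})"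
    using inf by (rule infinite_remove)
  then obtain t where t: "t \<in> ?E \<inter> ball p \<delta>" "t \<noteq> s"
    using infinite_imp_nonempty by blast
  have False if s: "s \<in> ?E \<inter> ball p \<delta>" and t: "t \<in> ?E \<inter> ball p \<delta>" and "s < t" for s t
  proof -
    have close: "dist (f x) (f p) < 1 / 2" if "x \<in> {s..t}" for x
      using that s t by (intro \<delta>) (auto simp: dist_real_def)
    have "f s = f t"
      using close[of s] close[of t] s t \<open>s < t\<close> by (auto simp: dist_real_def)
    then obtain r where "r \<in> {s<..<t}" "f r = 1 - f s"
      using extremes_alternate[of s t] s t \<open>s < t\<close> by auto
    then show False
      using close[of s] close[of r] s t by (auto simp: dist_real_def)
  qed
  then show False using s t by (cases "s < t") (auto simp: not_less_iff_gr_or_eq)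
qed

text \<open>
  A continuous function without local extrema inside \<open>(0, 1)\<close> can be unfolded at the points where it has
  the value \<open>0\<close> or \<open>1\<close>; its unfolding is strictly increasing, and the number of these points is its
  degree.  The summand \<open>f a\<close> starts the folding on the leg on which \<open>f\<close> starts.  The unfolding
  is \<open>\<bar>f x - f a\<bar>\<close> up to the first extreme \<open>b\<close> after \<open>a\<close>, and is continued by the
  one that starts at \<open>b\<close>.
\<close>

lemma unfold_open_map:
  assumes "a \<in> {0..1}" "f a \<in> {0, 1}" "card {x \<in> {a<..1}. f x \<in> {0, 1}} = k"
  shows "\<exists>F. continuous_on {a..1} F \<and> strict_mono_on {a..1} F \<and> F a = 0 \<and> F 1 = real k \<and>
             (\<forall>x\<in>{a..1}. f x = tent 1 (F x + f a))"
  using assms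
proof (induction k arbitrary: a)
  case 0
  let ?E = "{x \<in> {a<..1}. f x \<in> {0, 1}}"
  have "?E \<subseteq> {x \<in> {0..1}. f x \<in> {0, 1}}" using 0 by auto
  then have "finite ?E" using finite_extremes finite_subset by blast
  then have emp: "?E = {}" using 0 by simp
  have "a = 1"
  proof (rule ccontr)
    assume "a \<noteq> 1"
    then have "a < 1" using 0 by simp
    have c: "continuous_on {a..1} f"
      by (rule continuous_on_subset[OF cont]) (use 0 in auto)
    have W: "openin unit_interval {a<..1}"
    proof -
      have "{a<..1} = {0..1} \<inter> {a<..}" using 0 by auto
      then show ?thesis by (metis open_greaterThan openin_open_Int)
    qed
    have one: "f 1 \<noteq> 0" "f 1 \<noteq> 1" "f 1 \<in> {0..1}" using emp \<open>a < 1\<close> range[of 1] by auto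
    show False
    proof (cases "f a = 0")
      case True
      obtain m where m: "m \<in> {a..1}" "\<And>x. x \<in> {a..1} \<Longrightarrow> f x \<le> f m"
        using continuous_attains_sup[of "{a..1}" f] c 0 by auto
      have "m \<noteq> a" using m(2)[of 1] True one 0 by auto
      then have "f m = 1" using m by (intro open_map_interior_max[OF W]) auto
      then show False using emp m \<open>m \<noteq> a\<close> by auto
    next
      case False
      obtain m where m: "m \<in> {a..1}" "\<And>x. x \<in> {a..1} \<Longrightarrow> f m \<le> f x"
        using continuous_attains_inf[of "{a..1}" f] c 0 by auto
      have "m \<noteq> a" using m(2)[of 1] False one 0 by auto
      then have "f m = 0" using m by (intro open_map_interior_min[OF W]) auto
      then show False using emp m \<open>m \<noteq> a\<close> by auto
    qed
  qed
  then show ?case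
    using 0 by (intro exI[of _ "\<lambda>x. 0"]) (auto simp: strict_mono_on_def)
next
  case (Suc k)
  let ?E = "\<lambda>a. {x \<in> {a<..1}. f x \<in> {0, 1}}"
  have "?E a \<subseteq> {x \<in> {0..1}. f x \<in> {0, 1}}" using Suc by auto
  then have fin: "finite (?E a)" using finite_extremes finite_subset by blast
  define b where "b = Min (?E a)"
  have "?E a \<noteq> {}" using Suc.prems(3) by (metis card.empty nat.distinct(1))
  then have bE: "b \<in> ?E a" using fin Min_in unfolding b_def by blast
  then have ab: "a < b" "b \<le> 1" "0 \<le> a" and fb: "f b \<in> {0, 1}" using Suc.prems by auto
  have le: "b \<le> x" if "x \<in> ?E a" for x using that fin unfolding b_def by auto
  have none: "f r \<notin> {0, 1}" if "r \<in> {a<..<b}" for r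
    using le[of r] that ab by auto
  have "f a \<noteq> f b"
    using extremes_alternate[of a b] none ab Suc.prems(2) by auto
  then have fb': "f b = 1 - f a" using Suc.prems(2) fb by auto
  have "?E a = insert b (?E b)" using bE le ab by force
  then have "card (?E b) = k"
    using Suc.prems(3) fin by simp
  then obtain F where F: "continuous_on {b..1} F" "strict_mono_on {b..1} F" "F b = 0" "F 1 = real k"
      "\<And>x. x \<in> {b..1} \<Longrightarrow> f x = tent 1 (F x + f b)"
    using Suc.IH[of b] fb ab by auto
  define g where "g x = \<bar>f x - f a\<bar>" for x
  have c: "continuous_on {a..b} f"
    by (rule continuous_on_subset[OF cont]) (use ab in auto)
  have gc: "continuous_on {a..b} g"
    unfolding g_def by (intro continuous_intros c)
  have rg: "f x \<in> {0..1}" if "x \<in> {a..b}" for x using that ab by (intro range) auto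
  have g_eq: "g x = (if f a = 0 then f x else 1 - f x)" if "x \<in> {a..b}" for x
    using rg[OF that] Suc.prems(2) by (auto simp: g_def)
  have inj: "f s \<noteq> f t" if "s \<in> {a..b}" "t \<in> {a..b}" "s < t" for s t
    using extreme_between_equal_values[of s t] none that ab by fastforce
  have "inj_on g {a..b}"
  proof (rule inj_onI)
    fix s t assume st: "s \<in> {a..b}" "t \<in> {a..b}" "g s = g t"
    then have "f s = f t" by (auto simp: g_eq split: if_splits)
    then show "s = t" using inj[of s t] inj[of t s] st by fastforce
  qed
  then have "strict_mono_on {a..b} g \<or> strict_antimono_on {a..b} g"
    using injective_eq_monotone_map[OF is_interval_cc gc] by simp
  moreover have ga: "g a = 0" and gb: "g b = 1"
    using fb' Suc.prems(2) by (auto simp: g_def)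
  moreover have "\<not> strict_antimono_on {a..b} g"
  proof
    assume "strict_antimono_on {a..b} g"
    then have "g b < g a" by (rule monotone_onD) (use ab in auto)
    then show False using ga gb by simp
  qed
  ultimately have gm: "strict_mono_on {a..b} g"
    by blast
  define H where "H x = (if x \<le> b then g x else 1 + F x)" for x
  have H2: "H x = 1 + F x" if "b \<le> x" for x
    using that F(3) gb by (auto simp: H_def)
  have "continuous_on ({a..b} \<union> {b..1}) H"
    unfolding H_def
    by (rule continuous_on_If) (use gc F(1,3) gb in \<open>auto intro!: continuous_intros\<close>)
  moreover have "{a..b} \<union> {b..1} = {a..1}" using ab by auto
  ultimately have "continuous_on {a..1} H" by simp
  moreover have "strict_mono_on {a..1} H"
  proof (rule strict_mono_onI)
    fix x y assume xy: "x \<in> {a..1}" "y \<in> {a..1}" "x < y"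
    consider "y \<le> b" | "x \<le> b" "b < y" | "b < x" by linarith
    then show "H x < H y"
    proof cases
      case 1
      then show ?thesis using xy gm by (auto simp: H_def strict_mono_on_def)
    next
      case 2
      have "g x \<le> g b"
        using 2 xy strict_mono_on_leD[OF gm, of x b] by auto
      moreover have "F b < F y" using 2 xy strict_mono_onD[OF F(2), of b y] by auto
      ultimately show ?thesis using 2 gb F(3) by (simp add: H_def)
    next
      case 3
      then show ?thesis using xy strict_mono_onD[OF F(2), of x y] by (auto simp: H_def)
    qed
  qed
  moreover have "H a = 0" using ab ga by (simp add: H_def)
  moreover have "H 1 = real (Suc k)" using H2[of 1] ab F(4) by simp
  moreover have "f x = tent 1 (H x + f a)" if x: "x \<in> {a..1}" for x
  proof (cases "x \<le> b")
    case True
    then have x': "x \<in> {a..b}" using x by simp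
    show ?thesis
      using True g_eq[OF x'] rg[OF x'] Suc.prems(2)
      by (intro tent_eqI[of _ _ _ "if f a = 0 then 0 else 1", symmetric]) (auto simp: H_def)
  next
    case False
    have "tent 1 (H x + f a) = tent 1 (F x + f b)"
    proof (cases "f a = 0")
      case True
      then show ?thesis using H2[of x] False fb' by (simp add: add.commute)
    next
      case f: False
      then have "H x + f a = F x + 2" "f b = 0" using H2[of x] False fb' Suc.prems(2) by auto
      moreover have "tent 1 (F x + 2) = tent 1 (F x)"
        by (simp add: tent_def distrib_left mult.commute[of pi 2])
      ultimately show ?thesis by simp
    qed
    then show ?thesis using F(5)[of x] x False by simp
  qed
  ultimately show ?case by blast
qed

end

text \<open>The homeomorphism is the unfolding of \<open>f\<close>, rescaled to the unit interval.\<close>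

lemma open_surjection_tent_factor:
  assumes "open_surjection unit_interval unit_interval f" "f 0 = 0"
  obtains d h where "1 \<le> d" "homeomorphic_map unit_interval unit_interval h" "h 0 = 0"
    "\<And>x. x \<in> {0..1} \<Longrightarrow> f x = tent d (h x)"
proof -
  have c: "continuous_on {0..1} f" and o: "open_map unit_interval unit_interval f"
    and r: "\<And>x. x \<in> {0..1} \<Longrightarrow> f x \<in> {0..1}"
    using assms(1) by (auto simp: open_surjection_def)
  define d where "d = card {x \<in> {0<..1}. f x \<in> {0, 1}}"
  obtain F where F: "continuous_on {0..1} F" "strict_mono_on {0..1} F" "F 0 = 0" "F 1 = real d"
      "\<And>x. x \<in> {0..1} \<Longrightarrow> f x = tent 1 (F x + f 0)"
    using unfold_open_map[OF c r o, of 0 d] assms(2) d_def by auto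
  have "F 0 < F 1" by (rule strict_mono_onD[OF F(2)]) auto
  then have d: "1 \<le> d" using F by simp
  define h where "h x = F x / d" for x
  have h01: "h 0 = 0" "h 1 = 1" using F d by (auto simp: h_def)
  have hc: "continuous_on {0..1} h"
    unfolding h_def using d by (intro continuous_intros F) auto
  have hm: "h x < h y" if "x \<in> {0..1}" "y \<in> {0..1}" "x < y" for x y
    using strict_mono_onD[OF F(2) that(1,2,3)] d by (simp add: h_def divide_strict_right_mono)
  have img: "h ` {0..1} = {0..1}"
  proof
    show "h ` {0..1} \<subseteq> {0..1}"
      using hm[of 0] hm[of _ 1] h01 by (force simp: order_le_less)
    show "{0..1} \<subseteq> h ` {0..1}"
    proof
      fix y :: real assume "y \<in> {0..1}"
      then show "y \<in> h ` {0..1}"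
        using IVT'[of h 0 y 1] hc h01 by (auto simp: image_iff)
    qed
  qed
  have "inj_on h {0..1}"
    by (rule linorder_inj_onI) (use hm in force)+
  then have "homeomorphic_map unit_interval unit_interval h"
    using hc img
    by (intro continuous_imp_homeomorphic_map) (auto simp: compact_space_subtopology Hausdorff_space_subtopology)
  moreover have "f x = tent d (h x)" if "x \<in> {0..1}" for x
    using F(5)[OF that] assms(2) d by (simp add: tent_def h_def)
  ultimately show thesis using that d h01 by blast
qed

section \<open>The universal Knaster continuum\<close>

definition tent_limit :: "(nat \<Rightarrow> nat) \<Rightarrow> (nat \<Rightarrow> real) topology" where
  "tent_limit a = inv_limit (\<lambda>n. unit_interval) (\<lambda>n. tent (a n))"

text \<open>
  Under pointwise multiplication this is a compact group, and \<open>tent_limit a\<close> is its quotient by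
  inversion, which on the unit circle is conjugation.
\<close>

definition solenoid :: "(nat \<Rightarrow> nat) \<Rightarrow> (nat \<Rightarrow> complex) topology" where
  "solenoid a = inv_limit (\<lambda>n. unit_circle) (\<lambda>n w. w ^ a n)"

lemma topspace_tent_limit:
  "topspace (tent_limit a) = inv_limit_set (\<lambda>n. {0..1}) (\<lambda>n. tent (a n))"
  by (simp add: tent_limit_def topspace_inv_limit)

lemma topspace_solenoid:
  "topspace (solenoid a) = inv_limit_set (\<lambda>n. sphere 0 1) (\<lambda>n w. w ^ a n)"
  by (simp add: solenoid_def topspace_inv_limit)

lemma solenoid_normD: "z \<in> topspace (solenoid a) \<Longrightarrow> norm (z n) = 1"
  using inv_limit_setD(1)[of z "\<lambda>n. sphere 0 1"] by (simp add: topspace_solenoid)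

lemma solenoid_iff:
  "z \<in> topspace (solenoid a) \<longleftrightarrow> (\<forall>n. norm (z n) = 1) \<and> (\<forall>n. z (Suc n) ^ a n = z n)"
  by (simp add: topspace_solenoid inv_limit_set_def)

lemma inv_limit_tent_power:
  assumes "x \<in> inv_limit_set X (\<lambda>n. tent (a n))" "\<And>n. X n \<subseteq> {0..1}" "n \<le> m"
  shows "x n = tent (\<Prod>j\<in>{n..<m}. a j) (x m)"
  using assms(3)
proof (induction m rule: dec_induct)
  case base
  then show ?case using inv_limit_setD(1)[OF assms(1), of n] assms(2)[of n] by auto
next
  case (step m)
  then show ?case
    using inv_limit_setD(2)[OF assms(1), of m]
    by (simp add: prod.atLeastLessThan_Suc flip: tent_tent)
qed

lemma solenoid_power:
  assumes "z \<in> topspace (solenoid a)" "n \<le> m"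
  shows "z n = z m ^ (\<Prod>j\<in>{n..<m}. a j)"
  using assms(2)
proof (induction m rule: dec_induct)
  case (step m)
  moreover have "z m = z (Suc m) ^ a m" using assms(1) by (simp add: solenoid_iff)
  ultimately show ?case
    by (simp add: prod.atLeastLessThan_Suc power_mult[symmetric] mult.commute)
qed simp

lemma compact_space_solenoid: "compact_space (solenoid a)"
  unfolding solenoid_def
  by (rule compact_space_inv_limit)
    (auto simp: compact_space_subtopology Hausdorff_space_subtopology norm_power intro!: continuous_intros)

lemma compact_space_tent_limit: "compact_space (tent_limit a)"
  unfolding tent_limit_def
  by (rule compact_space_inv_limit)
    (use continuous_map_tent in \<open>auto simp: compact_space_subtopology Hausdorff_space_subtopology\<close>)

lemma Hausdorff_space_tent_limit: "Hausdorff_space (tent_limit a)"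
  unfolding tent_limit_def by (intro Hausdorff_space_inv_limit) (simp add: Hausdorff_space_subtopology)

lemma continuous_map_solenoid_coord: "continuous_map (solenoid a) unit_circle (\<lambda>z. z n)"
  unfolding solenoid_def by (rule continuous_map_inv_limit_coord)

lemma continuous_map_tent_limit_coord: "continuous_map (tent_limit a) unit_interval (\<lambda>z. z n)"
  unfolding tent_limit_def by (rule continuous_map_inv_limit_coord)

lemma continuous_map_solenoidI:
  assumes "\<And>n. continuous_map (solenoid a) unit_circle (\<lambda>z. g z n)"
    and "\<And>z. z \<in> topspace (solenoid a) \<Longrightarrow> g z \<in> topspace (solenoid a)"
  shows "continuous_map (solenoid a) (solenoid a) g"
  using continuous_map_into_inv_limit[of "solenoid a" "\<lambda>n. unit_circle" g "\<lambda>n w. w ^ a n"] assms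
  by (simp add: solenoid_def[symmetric] solenoid_iff)

context
  fixes a d m e :: "nat \<Rightarrow> nat"
  assumes a: "\<And>n. 1 \<le> a n" and d: "\<And>n. 1 \<le> d n" and m: "\<And>n. m n \<le> m (Suc n)"
    and e: "\<And>n. e n * (\<Prod>j<n. d j) = (\<Prod>j<m n. a j)"
begin

text \<open>
  The hypothesis on \<open>e\<close> makes the power maps \<open>w \<mapsto> w ^ e n\<close> from the coordinate \<open>m n\<close> of the solenoid of \<open>a\<close>
  to the coordinate \<open>n\<close> of the solenoid of \<open>d\<close> commute with the bonding maps.  They define a
  homomorphism of solenoids.
\<close>

lemma solenoid_epi_step:
  assumes z: "z \<in> topspace (solenoid a)"
  shows "(z (m (Suc n)) ^ e (Suc n)) ^ d n = z (m n) ^ e n"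
proof -
  let ?p = "\<Prod>j\<in>{m n..<m (Suc n)}. a j"
  have "(\<Prod>j<m (Suc n). a j) = (\<Prod>j<m n. a j) * ?p"
    using prod.atLeastLessThan_concat[of 0 "m n" "m (Suc n)" a] m[of n] by (simp add: lessThan_atLeast0)
  then have "(\<Prod>j<n. d j) * (e (Suc n) * d n) = (\<Prod>j<n. d j) * (?p * e n)"
    using e[of n] e[of "Suc n"] by (simp add: mult_ac)
  moreover have "(\<Prod>j<n. d j) \<noteq> 0"
    using d by (metis One_nat_def not_less_eq_eq prod_zero_iff finite_lessThan zero_le)
  ultimately have "e (Suc n) * d n = ?p * e n" by simp
  then have "(z (m (Suc n)) ^ e (Suc n)) ^ d n = (z (m (Suc n)) ^ ?p) ^ e n"
    by (simp add: power_mult[symmetric])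
  then show ?thesis using solenoid_power[OF z m[of n]] by metis
qed

lemma solenoid_epi: 
  assumes "z \<in> topspace (solenoid a)"
  shows "(\<lambda>n. z (m n) ^ e n) \<in> topspace (solenoid d)"
  using solenoid_epi_step[OF assms] solenoid_normD[OF assms] by (simp add: solenoid_iff norm_power)

lemma continuous_map_fold_epi:
  "continuous_map (solenoid a) unit_interval (\<lambda>z. circle_fold (z (m n) ^ e n))"
proof -
  have "continuous_map unit_circle unit_circle (\<lambda>w. w ^ e n)"
    by (auto simp: norm_power intro!: continuous_intros)
  from continuous_map_compose[OF continuous_map_compose[OF continuous_map_solenoid_coord this]
      continuous_map_circle_fold]
  show ?thesis by (simp add: o_def)
qed

text \<open>
  A single coordinate can be prescribed, and prescribing the coordinate \<open>n + 1\<close> prescribes the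
  coordinate \<open>n\<close>, so that compactness applies.
\<close>

lemma solenoid_onto_tent_limit:
  assumes y: "y \<in> topspace (tent_limit d)"
  shows "\<exists>z \<in> topspace (solenoid a). \<forall>n. circle_fold (z (m n) ^ e n) = y n"
proof -
  define F where "F n = {z \<in> topspace (solenoid a). circle_fold (z (m n) ^ e n) = y n}" for n
  have y01: "y n \<in> {0..1}" for n
    using inv_limit_setD(1)[OF y[unfolded topspace_tent_limit]] .
  obtain z where "z \<in> topspace (solenoid a)" "\<And>n. z \<in> F n"
  proof (rule compact_space_nested_closed[OF compact_space_solenoid])
    show "closedin (solenoid a) (F n)" for n
      unfolding F_def
      by (rule closedin_continuous_maps_eq[OF _ continuous_map_fold_epi])
        (use y01 in \<open>auto simp: Hausdorff_space_subtopology\<close>)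
    show "F n \<noteq> {}" for n
    proof -
      \<comment> \<open>the point is taken on the one-parameter subgroup \<open>t \<mapsto> (\<lambda>k. cis (t / A k))\<close>\<close>
      define A where "A k = real (\<Prod>j<k. a j)" for k
      define D where "D = real (\<Prod>j<n. d j)"
      have A_Suc: "A (Suc k) = real (a k) * A k" for k by (simp add: A_def)
      have a0: "a k \<noteq> 0" for k using a[of k] by simp
      then have A0: "A k \<noteq> 0" for k by (simp add: A_def)
      define z where "z k = cis (pi * y n * D / A k)" for k
      have "z (Suc k) ^ a k = z k" for k
        using a0[of k] A0[of k] by (simp add: z_def Complex.DeMoivre A_Suc)
      moreover have "norm (z k) = 1" for k by (simp add: z_def)
      ultimately have "z \<in> topspace (solenoid a)"
        by (simp add: solenoid_iff)
      moreover have "z (m n) ^ e n = cis (pi * y n)"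
      proof -
        have "real (e n) * D = A (m n)"
          unfolding A_def D_def using e[of n] by (metis of_nat_mult)
        moreover have "real (e n) * (pi * y n * D / A (m n)) = pi * y n * (real (e n) * D) / A (m n)"
          by simp
        ultimately show ?thesis using A0[of "m n"] by (simp add: z_def Complex.DeMoivre)
      qed
      ultimately show ?thesis
        using y01[of n] by (auto simp: F_def)
    qed
    show "F (Suc n) \<subseteq> F n" for n
    proof
      fix z assume z: "z \<in> F (Suc n)"
      then have zs: "z \<in> topspace (solenoid a)" by (simp add: F_def)
      have "circle_fold (z (m n) ^ e n) = tent (d n) (circle_fold (z (m (Suc n)) ^ e (Suc n)))"
        using solenoid_epi_step[OF zs, of n] solenoid_normD[OF zs]
        by (simp add: norm_power flip: circle_fold_power)
      also have "\<dots> = y n"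
        using z inv_limit_setD(2)[OF y[unfolded topspace_tent_limit], of n] by (simp add: F_def)
      finally show "z \<in> F n" using zs by (simp add: F_def)
    qed
  qed blast
  then show ?thesis by (auto simp: F_def)
qed

text \<open>
  Two points of the solenoid with the same folded image differ, up to conjugation, by an element of
  the kernel; the alternative is the same for all coordinates because every coordinate is a power
  of each later one.
\<close>

lemma solenoid_fibres_homogeneous:
  assumes z: "z \<in> topspace (solenoid a)" and z': "z' \<in> topspace (solenoid a)"
    and eq: "\<And>n. circle_fold (z (m n) ^ e n) = circle_fold (z' (m n) ^ e n)"
  shows "\<exists>g. continuous_map (solenoid a) (solenoid a) g \<and> g z = z' \<and>
     (\<forall>y\<in>topspace (solenoid a). \<forall>n. circle_fold (g y (m n) ^ e n) = circle_fold (y (m n) ^ e n))"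
proof -
  define v where "v n = z (m n) ^ e n" for n
  define v' where "v' n = z' (m n) ^ e n" for n
  have v: "v \<in> topspace (solenoid d)" "v' \<in> topspace (solenoid d)"
    unfolding v_def[abs_def] v'_def[abs_def] by (rule solenoid_epi[OF z], rule solenoid_epi[OF z'])
  have alt: "v' n = v n \<or> v' n = cnj (v n)" for n
    by (rule circle_fold_eqD)
      (use eq solenoid_normD[OF v(1)] solenoid_normD[OF v(2)] in \<open>auto simp: v_def v'_def\<close>)
  have "(\<forall>n. v' n = v n) \<or> (\<forall>n. v' n = cnj (v n))"
  proof (rule ccontr)
    assume "\<not> ?thesis"
    then obtain i j where i: "v' i \<noteq> v i" and j: "v' j \<noteq> cnj (v j)" by blast
    let ?k = "max i j"
    have "v' ?k \<noteq> v ?k"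
      using i solenoid_power[OF v(1), of i ?k] solenoid_power[OF v(2), of i ?k] by (metis max.cobounded1)
    moreover have "v' ?k \<noteq> cnj (v ?k)"
      using j solenoid_power[OF v(1), of j ?k] solenoid_power[OF v(2), of j ?k]
      by (metis complex_cnj_power max.cobounded2)
    ultimately show False using alt by blast
  qed
  have nz: "z n \<noteq> 0" "z' n \<noteq> 0" for n
    using solenoid_normD[OF z, of n] solenoid_normD[OF z', of n] by auto
  note nrm = solenoid_normD[OF z] solenoid_normD[OF z']
  from \<open>(\<forall>n. v' n = v n) \<or> (\<forall>n. v' n = cnj (v n))\<close> show ?thesis
  proof
    assume "\<forall>n. v' n = v n"
    then have ker: "z' (m n) ^ e n = z (m n) ^ e n" for n by (simp add: v_def v'_def)
    let ?g = "\<lambda>y n. y n * (z' n / z n)"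
    have "?g y \<in> topspace (solenoid a)" if "y \<in> topspace (solenoid a)" for y
      using that z z' by (simp add: solenoid_iff norm_mult norm_divide power_mult_distrib power_divide)
    moreover have "continuous_map unit_circle unit_circle (\<lambda>w. w * (z' n / z n))" for n
      using nrm nz by (auto simp: norm_mult norm_divide intro!: continuous_intros)
    from continuous_map_compose[OF continuous_map_solenoid_coord this]
    have "continuous_map (solenoid a) unit_circle (\<lambda>y. ?g y n)" for n by (simp add: o_def)
    ultimately have "continuous_map (solenoid a) (solenoid a) ?g"
      by (intro continuous_map_solenoidI)
    then show ?thesis
      using nz ker by (intro exI[of _ ?g]) (auto simp: power_mult_distrib power_divide)
  next
    assume "\<forall>n. v' n = cnj (v n)"
    then have ker: "z' (m n) ^ e n = cnj (z (m n)) ^ e n" for n by (simp add: v_def v'_def)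
    let ?g = "\<lambda>y n. cnj (y n) * (z' n / cnj (z n))"
    have "?g y \<in> topspace (solenoid a)" if "y \<in> topspace (solenoid a)" for y
      using that z z'
      by (simp add: solenoid_iff norm_mult norm_divide power_mult_distrib power_divide flip: complex_cnj_power)
    moreover have "continuous_map unit_circle unit_circle (\<lambda>w. cnj w * (z' n / cnj (z n)))" for n
      using nrm nz by (auto simp: norm_mult norm_divide intro!: continuous_intros)
    from continuous_map_compose[OF continuous_map_solenoid_coord this]
    have "continuous_map (solenoid a) unit_circle (\<lambda>y. ?g y n)" for n by (simp add: o_def)
    ultimately have "continuous_map (solenoid a) (solenoid a) ?g"
      by (intro continuous_map_solenoidI)
    moreover have "circle_fold (?g y (m n) ^ e n) = circle_fold (y (m n) ^ e n)" for y n
    proof -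
      have "?g y (m n) ^ e n = cnj (y (m n) ^ e n)"
        using nz by (simp add: power_mult_distrib power_divide ker)
      then show ?thesis by (simp only: circle_fold_cnj)
    qed
    ultimately show ?thesis
      using nz by (intro exI[of _ ?g]) auto
  qed
qed

end

text \<open>
  If \<open>H n\<close> is a homeomorphism which fixes \<open>0\<close>, then \<open>H n \<circ> T n\<close> is again an open surjection which fixes
  \<open>0\<close>, and its factorisation into a tent map and a homeomorphism supplies \<open>H (Suc n)\<close>.
\<close>

lemma Knaster_bonding_maps_straighten:
  assumes T: "\<And>n. open_surjection unit_interval unit_interval (T n)" "\<And>n. T n 0 = 0"
  obtains d H where "\<And>n. (1::nat) \<le> d n" "\<And>n. homeomorphic_map unit_interval unit_interval (H n)"
    "\<And>n x. x \<in> {0..1} \<Longrightarrow> H n (T n x) = tent (d n) (H (Suc n) x)"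
proof -
  let ?P = "\<lambda>n::nat. \<lambda>h::real \<Rightarrow> real. homeomorphic_map unit_interval unit_interval h \<and> h 0 = 0"
  let ?Q = "\<lambda>n h h'. \<exists>d\<ge>1. \<forall>x\<in>{0..1}. h (T n x) = tent d (h' x)"
  have "\<exists>f. \<forall>n. ?P n (f n) \<and> ?Q n (f n) (f (Suc n))"
  proof (rule dependent_nat_choice[of ?P ?Q])
    show "\<exists>h. ?P 0 h" by (intro exI[of _ "\<lambda>x. x"]) (simp add: homeomorphic_map_id[unfolded id_def])
    fix h n assume h: "?P n h"
    then have "open_surjection unit_interval unit_interval h"
      by (simp add: homeomorphic_eq_everything_map open_surjection_def)
    moreover have "(h \<circ> T n) ` {0..1} = h ` T n ` {0..1}"
      by (simp only: image_comp)
    ultimately have "open_surjection unit_interval unit_interval (h \<circ> T n)"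
      using T(1)[of n] continuous_map_compose[of unit_interval unit_interval "T n" unit_interval h]
        open_map_compose[of unit_interval unit_interval "T n" unit_interval h]
      by (simp add: open_surjection_def del: continuous_map_iff_continuous2)
    then obtain d h' where "1 \<le> d" "?P (Suc n) h'" "\<And>x. x \<in> {0..1} \<Longrightarrow> (h \<circ> T n) x = tent d (h' x)"
    proof (rule open_surjection_tent_factor)
      show "(h \<circ> T n) 0 = 0" using h T(2) by simp
    qed blast
    then show "\<exists>h'. ?P (Suc n) h' \<and> ?Q n h h'" by auto
  qed
  then obtain H where H: "\<And>n. ?P n (H n)" "\<And>n. ?Q n (H n) (H (Suc n))" by blast
  from choice[OF allI, of "\<lambda>n d. 1 \<le> d \<and> (\<forall>x\<in>{0..1}. H n (T n x) = tent d (H (Suc n) x))", OF H(2)]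
  show thesis using that H(1) by (metis (lifting))
qed

text \<open>
  After straightening, the bonding maps of the target are the \<open>tent (d n)\<close>.  Since every product of
  the \<open>d n\<close> divides some product of the \<open>a n\<close>, a tent map \<open>tent (e n)\<close> from a far enough coordinate
  of the source is available for each coordinate of the target.  These maps commute with the bonding
  maps; their limit is open because it becomes so after composition with the map from the solenoid.
\<close>

lemma tent_limit_onto_Knaster:
  assumes a: "\<And>n. 1 \<le> a n" and cofinal: "\<And>n. Suc n dvd a n" and X: "Knaster_continuum X"
  shows "\<exists>\<phi>. open_surjection (tent_limit a) X \<phi>"
proof -
  from X obtain T where "\<forall>n. open_surjection unit_interval unit_interval (T n) \<and> T n 0 = 0"
      and X_eq: "X = inv_limit (\<lambda>n. unit_interval) T"
    unfolding Knaster_continuum_def by blast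
  then have T: "\<And>n. open_surjection unit_interval unit_interval (T n)" "\<And>n. T n 0 = 0"
    by blast+
  obtain d H where d: "\<And>n. 1 \<le> d n" and H: "\<And>n. homeomorphic_map unit_interval unit_interval (H n)"
      and HT: "\<And>n x. x \<in> {0..1} \<Longrightarrow> H n (T n x) = tent (d n) (H (Suc n) x)"
    using Knaster_bonding_maps_straighten[of T] T by (metis (no_types))
  have "\<exists>g. homeomorphic_maps unit_interval unit_interval (H n) g" for n
    using H homeomorphic_map_maps by blast
  then obtain G where G: "\<And>n. homeomorphic_maps unit_interval unit_interval (H n) (G n)"
    by metis
  have Gc: "continuous_map unit_interval unit_interval (G n)"
    and GI: "x \<in> {0..1} \<Longrightarrow> G n x \<in> {0..1}" and HI: "x \<in> {0..1} \<Longrightarrow> H n x \<in> {0..1}"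
    and GH: "x \<in> {0..1} \<Longrightarrow> G n (H n x) = x" and HG: "x \<in> {0..1} \<Longrightarrow> H n (G n x) = x" for n x
    using G[of n] by (auto simp: homeomorphic_maps_def)
  have TI: "x \<in> {0..1} \<Longrightarrow> T n x \<in> {0..1}" for n x
    using T(1)[of n] by (auto simp: open_surjection_def)

  \<comment> \<open>the product over \<open>j < m n\<close> contains the factor \<open>a (D n - 1)\<close>, a multiple of \<open>D n\<close>\<close>
  define D where "D n = (\<Prod>j<n. d j)" for n
  define m where "m n = n + D n" for n
  define e where "e n = (\<Prod>j<m n. a j) div D n" for n
  have D0: "0 < D n" for n
  proof -
    have "0 < d j" for j using d[of j] by simp
    then show ?thesis unfolding D_def by (intro prod_pos)
  qed
  have m: "m n \<le> m (Suc n)" for n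
  proof -
    have "D n * 1 \<le> D n * d n" by (intro mult_le_mono2 d)
    moreover have "D (Suc n) = D n * d n" by (simp add: D_def)
    ultimately show ?thesis unfolding m_def by linarith
  qed
  have "D n dvd (\<Prod>j<m n. a j)" for n
  proof -
    have "D n dvd a (D n - 1)" using cofinal[of "D n - 1"] D0[of n] by simp
    also have "a (D n - 1) dvd (\<Prod>j<m n. a j)"
      by (rule dvd_prodI) (use D0[of n] in \<open>auto simp: m_def\<close>)
    finally show ?thesis .
  qed
  then have e: "e n * (\<Prod>j<n. d j) = (\<Prod>j<m n. a j)" for n
    by (simp add: e_def D_def)
  note epi = a d m e

  define \<phi> where "\<phi> u n = G n (tent (e n) (u (m n)))" for u n
  define s where "s z n = circle_fold (z n)" for z :: "nat \<Rightarrow> complex" and n :: nat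
  define q where "q z = \<phi> (s z)" for z
  have fold_epi: "tent (e n) (s z (m n)) = circle_fold (z (m n) ^ e n)" if "z \<in> topspace (solenoid a)" for z n
    using solenoid_normD[OF that] by (simp add: s_def circle_fold_power)

  have s: "continuous_map (solenoid a) (tent_limit a) s"
    unfolding tent_limit_def
  proof (rule continuous_map_into_inv_limit)
    show "continuous_map (solenoid a) unit_interval (\<lambda>z. s z n)" for n
      using continuous_map_compose[OF continuous_map_solenoid_coord continuous_map_circle_fold]
      by (simp add: s_def o_def)
    show "tent (a n) (s z (Suc n)) = s z n" if z: "z \<in> topspace (solenoid a)" for z n
    proof -
      have "tent (a n) (s z (Suc n)) = circle_fold (z (Suc n) ^ a n)"
        using solenoid_normD[OF z] by (simp add: s_def circle_fold_power)
      then show ?thesis using z by (simp add: s_def solenoid_iff)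
    qed
  qed
  have s_onto: "s ` topspace (solenoid a) = topspace (tent_limit a)"
  proof
    show "s ` topspace (solenoid a) \<subseteq> topspace (tent_limit a)"
      by (rule continuous_map_image_subset_topspace[OF s])
    show "topspace (tent_limit a) \<subseteq> s ` topspace (solenoid a)"
    proof
      fix u assume u: "u \<in> topspace (tent_limit a)"
      \<comment> \<open>the case in which source and target have the same degrees\<close>
      obtain z where "z \<in> topspace (solenoid a)" "\<forall>n. circle_fold (z n ^ 1) = u n"
        using solenoid_onto_tent_limit[of a a "\<lambda>n. n" "\<lambda>n. 1" u] a u by auto
      then show "u \<in> s ` topspace (solenoid a)"
        by (intro image_eqI[of _ _ z]) (auto simp: s_def)
    qed
  qed

  have \<phi>: "continuous_map (tent_limit a) X \<phi>"
    unfolding X_eq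
  proof (rule continuous_map_into_inv_limit)
    show "continuous_map (tent_limit a) unit_interval (\<lambda>u. \<phi> u n)" for n
      using continuous_map_compose[OF continuous_map_compose[OF continuous_map_tent_limit_coord
          continuous_map_tent] Gc]
      by (simp add: \<phi>_def o_def)
    show "T n (\<phi> u (Suc n)) = \<phi> u n" if u: "u \<in> topspace (tent_limit a)" for u n
    proof -
      obtain z where z: "z \<in> topspace (solenoid a)" and uz: "u = s z" using u s_onto by blast
      let ?w = "\<lambda>n. z (m n) ^ e n"
      have w: "tent (e n) (u (m n)) = circle_fold (?w n)" "?w n \<in> sphere 0 1" for n
        using fold_epi[OF z] uz solenoid_normD[OF z] by (auto simp: norm_power)
      have I: "\<phi> u n \<in> {0..1}" for n
        unfolding \<phi>_def by (intro GI) (use tent_bounds in auto)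
      have "H n (T n (\<phi> u (Suc n))) = tent (d n) (tent (e (Suc n)) (u (m (Suc n))))"
        using HT[OF I] HG[of "tent (e (Suc n)) (u (m (Suc n)))"] tent_bounds by (simp add: \<phi>_def)
      also have "\<dots> = circle_fold (?w (Suc n) ^ d n)"
        using w by (simp add: circle_fold_power)
      also have "\<dots> = tent (e n) (u (m n))"
        using solenoid_epi_step[OF epi z, of n] w by simp
      finally have "G n (H n (T n (\<phi> u (Suc n)))) = \<phi> u n"
        by (simp add: \<phi>_def)
      then show ?thesis using GH[OF TI[OF I]] by simp
    qed
  qed

  have q: "continuous_map (solenoid a) X q"
    using continuous_map_compose[OF s \<phi>] by (simp add: q_def[abs_def] o_def)
  have q_onto: "q ` topspace (solenoid a) = topspace X"
  proof
    show "q ` topspace (solenoid a) \<subseteq> topspace X"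
      by (rule continuous_map_image_subset_topspace[OF q])
    show "topspace X \<subseteq> q ` topspace (solenoid a)"
    proof
      fix x assume "x \<in> topspace X"
      then have x: "x n \<in> {0..1}" "T n (x (Suc n)) = x n" for n
        using inv_limit_setD[of x "\<lambda>n. {0..1}" T] by (auto simp: X_eq topspace_inv_limit)
      have "tent (d n) (H (Suc n) (x (Suc n))) = H n (x n)" for n
        using HT[OF x(1), of n "Suc n"] x(2) by simp
      then have "(\<lambda>n. H n (x n)) \<in> topspace (tent_limit d)"
        using HI[OF x(1)] by (simp add: topspace_tent_limit inv_limit_set_def)
      then obtain z where z: "z \<in> topspace (solenoid a)" "\<And>n. circle_fold (z (m n) ^ e n) = H n (x n)"
        using solenoid_onto_tent_limit[OF epi] by blast
      then have "q z = x"
        using fold_epi[OF z(1)] GH[OF x(1)] by (auto simp: q_def \<phi>_def)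
      then show "x \<in> q ` topspace (solenoid a)" using z(1) by blast
    qed
  qed
  have "open_map (solenoid a) X q"
  proof (rule open_map_if_fibres_homogeneous[OF compact_space_solenoid _ q q_onto])
    show "Hausdorff_space X"
      unfolding X_eq by (intro Hausdorff_space_inv_limit) (simp add: Hausdorff_space_subtopology)
    fix z z' assume z: "z \<in> topspace (solenoid a)" "z' \<in> topspace (solenoid a)" "q z = q z'"
    have "tent (e n) (s z (m n)) = tent (e n) (s z' (m n))" for n
    proof -
      have "\<phi> (s z) n = \<phi> (s z') n" using z(3) by (simp add: q_def)
      then have "H n (G n (tent (e n) (s z (m n)))) = H n (G n (tent (e n) (s z' (m n))))"
        by (simp add: \<phi>_def)
      then show ?thesis
        using HG tent_bounds by simp
    qed
    then have "circle_fold (z (m n) ^ e n) = circle_fold (z' (m n) ^ e n)" for n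
      using fold_epi z(1,2) by metis
    from solenoid_fibres_homogeneous[OF epi z(1,2) this] obtain g
      where g: "continuous_map (solenoid a) (solenoid a) g" "g z = z'"
        "\<And>y n. y \<in> topspace (solenoid a) \<Longrightarrow>
           circle_fold (g y (m n) ^ e n) = circle_fold (y (m n) ^ e n)"
      by blast
    have "q (g y) = q y" if y: "y \<in> topspace (solenoid a)" for y
    proof -
      have "g y \<in> topspace (solenoid a)"
        using continuous_map_image_subset_topspace[OF g(1)] y by blast
      then have "tent (e n) (s (g y) (m n)) = tent (e n) (s y (m n))" for n
        using fold_epi y g(3)[OF y] by metis
      then show ?thesis by (simp add: q_def \<phi>_def[abs_def])
    qed
    then show "\<exists>g. continuous_map (solenoid a) (solenoid a) g \<and> g z = z' \<and>
        (\<forall>y\<in>topspace (solenoid a). q (g y) = q y)"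
      using g by blast
  qed
  then have "open_map (tent_limit a) X \<phi>"
    by (rule open_map_cancel_right[OF s s_onto]) (simp add: q_def)
  moreover have "\<phi> ` topspace (tent_limit a) = topspace X"
    using q_onto s_onto by (metis (no_types, lifting) image_cong image_image q_def)
  ultimately show ?thesis
    using \<phi> by (auto simp: open_surjection_def)
qed

lemma universal_Knaster_continuum_tent_limit:
  assumes "\<And>n. 1 \<le> a n" "\<And>n. Suc n dvd a n"
  shows "universal_Knaster_continuum (tent_limit a)"
  unfolding universal_Knaster_continuum_def
proof (intro conjI allI impI)
  show "Knaster_continuum (tent_limit a)"
    unfolding Knaster_continuum_def tent_limit_def using open_surjection_tent assms(1)
    by (intro exI[of _ "\<lambda>n. tent (a n)"]) simp
qed (rule tent_limit_onto_Knaster[OF assms])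

section \<open>Unfolding the morphisms between finite linear graphs\<close>

text \<open>
  \<open>v\<close> is the point of \<open>{0..M}\<close> onto which \<open>t\<close> falls when the half-line is folded at the
  multiples of \<open>M\<close>.
\<close>

definition folds_to :: "nat \<Rightarrow> nat \<Rightarrow> nat \<Rightarrow> bool" where
  "folds_to M t v \<longleftrightarrow> v \<le> M \<and>
     (\<exists>c::int. int t = 2 * c * int M + int v \<or> int t = 2 * c * int M - int v)"

text \<open>
  These are the unfoldings of morphisms: paths on the half-line that start at \<open>0\<close> and at each step
  stay where they are or move on by \<open>1\<close>.
\<close>

definition slow_fun :: "nat \<Rightarrow> (nat \<Rightarrow> nat) \<Rightarrow> bool" where
  "slow_fun n F \<longleftrightarrow> F 0 = 0 \<and> (\<forall>a. Suc a < n \<longrightarrow> F (Suc a) = F a \<or> F (Suc a) = Suc (F a))"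

lemma folds_toI:
  assumes "j * M \<le> t" "t \<le> Suc j * M"
  shows "folds_to M t (if even j then t - j * M else Suc j * M - t)"
proof (cases "even j")
  case True
  then obtain i where "j = 2 * i" by blast
  then show ?thesis using assms
    by (auto simp: folds_to_def intro!: exI[of _ "int i"])
next
  case False
  then obtain i where i: "j = Suc (2 * i)" using oddE by (metis Suc_eq_plus1)
  then have "int t = 2 * (int i + 1) * int M - int (Suc j * M - t)"
    using assms(2) by (simp add: algebra_simps of_nat_diff)
  moreover have "Suc j * M - t \<le> M" using assms by simp
  ultimately show ?thesis using False unfolding folds_to_def by (metis (full_types))
qed

lemma folds_to_unique:
  assumes "folds_to M t v" "folds_to M t w" "1 \<le> M"
  shows "v = w"
proof -
  obtain c c' where c: "int t = 2 * c * int M + int v \<or> int t = 2 * c * int M - int v"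
    and c': "int t = 2 * c' * int M + int w \<or> int t = 2 * c' * int M - int w"
    using assms by (auto simp: folds_to_def)
  have b: "int v \<le> int M" "int w \<le> int M" "1 \<le> int M" using assms by (auto simp: folds_to_def)
  define D where "D = 2 * (c - c') * int M"
  have D: "D = 2 * c * int M - 2 * c' * int M" by (simp add: D_def algebra_simps)
  have D2: "D = 2 * ((c - c') * int M)" by (simp add: D_def)
  have "D = 0 \<or> D \<ge> 2 * int M \<or> D \<le> - 2 * int M"
  proof -
    consider "c = c'" | "c - c' \<ge> 1" | "c - c' \<le> - 1" by linarith
    then show ?thesis
    proof cases
      case 2
      then have "1 * int M \<le> (c - c') * int M" by (intro mult_right_mono) auto
      then show ?thesis unfolding D2 by linarith
    next
      case 3
      then have "(c - c') * int M \<le> - 1 * int M" by (intro mult_right_mono) auto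
      then show ?thesis unfolding D2 by linarith
    qed (simp add: D_def)
  qed
  then have "int v = int w" using c c' b unfolding D by linarith
  then show ?thesis by simp
qed

lemma folds_to_eq:
  assumes "folds_to M t v" "1 \<le> M" "j * M \<le> t" "t \<le> Suc j * M"
  shows "v = (if even j then t - j * M else Suc j * M - t)"
  using folds_to_unique[OF assms(1) folds_toI[OF assms(3,4)] assms(2)] .

lemma div_bounds: "1 \<le> M \<Longrightarrow> (t div M) * M \<le> t \<and> t < Suc (t div M) * (M::nat)"
  using dividend_less_div_times[of M t] by auto

lemma folds_to_Suc:
  assumes "folds_to M t v" "folds_to M (Suc t) w" "1 \<le> M"
  shows "w = Suc v \<or> v = Suc w"
proof -
  obtain j where j: "j * M \<le> t" "t < Suc j * M" using div_bounds[OF assms(3)] by blast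
  then show ?thesis
    using folds_to_eq[OF assms(1,3), of j] folds_to_eq[OF assms(2,3), of j]
    by (auto split: if_splits)
qed

lemma slow_fun_mono:
  assumes "slow_fun n F" "a \<le> b" "b < n"
  shows "F a \<le> F b"
  using assms(2,3)
proof (induction b rule: dec_induct)
  case (step b)
  then show ?case using assms(1) by (fastforce simp: slow_fun_def)
qed simp

lemma slow_fun_IVT:
  assumes "slow_fun n F" "t \<le> F b" "b < n"
  shows "\<exists>a\<le>b. F a = t"
  using assms(2,3)
proof (induction b)
  case 0
  then show ?case using assms(1) by (auto simp: slow_fun_def)
next
  case (Suc b)
  show ?case
  proof (cases "t \<le> F b")
    case True
    then show ?thesis using Suc by (meson Suc_lessD le_Suc_eq)
  next
    case False
    then have "t = F (Suc b)" using Suc.prems assms(1) by (fastforce simp: slow_fun_def)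
    then show ?thesis by blast
  qed
qed

lemma slow_fun_last:
  assumes F: "slow_fun n F" and t: "t \<le> F (n - 1)" and n: "1 \<le> n"
  obtains a where "a < n" "F a = t" "\<And>b. a < b \<Longrightarrow> b < n \<Longrightarrow> t < F b"
proof -
  define S where "S = {a. a < n \<and> F a = t}"
  obtain a where "a \<le> n - 1" "F a = t" using slow_fun_IVT[OF F t] n by auto
  then have "a \<in> S" using n by (simp add: S_def)
  then have "finite S" "S \<noteq> {}" by (auto simp: S_def)
  then have m: "Max S \<in> S" "\<And>b. b \<in> S \<Longrightarrow> b \<le> Max S" by auto
  show thesis
  proof (rule that[of "Max S"])
    fix b assume b: "Max S < b" "b < n"
    then have "F (Max S) \<le> F b" using slow_fun_mono[OF F] by simp
    then show "t < F b" using m b unfolding S_def by fastforce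
  qed (use m in \<open>auto simp: S_def\<close>)
qed

text \<open>
  The maps \<open>f\<close> with an unfolding \<open>F\<close> that ends at a multiple of \<open>M\<close> are the morphisms: the turning
  points of \<open>f\<close> are where \<open>F\<close> reaches the multiples of \<open>M\<close>.  Unlike the sequence of turning points, the
  unfolding is easy to compose and to lift.
\<close>

lemma lg_morphismI:
  assumes F: "slow_fun n F" and last: "F (n - 1) = k * M" and M: "1 \<le> M" and k: "1 \<le> k"
    and fold: "\<And>a. a < n \<Longrightarrow> folds_to M (F a) (f a)"
  shows "lg_morphism n (Suc M) f"
proof -
  have F0: "F 0 = 0" using F by (simp add: slow_fun_def)
  have "F (n - 1) \<noteq> F 0" using last M k F0 by auto
  then have n: "2 \<le> n" by (cases n; cases "n - 1") auto
  have f_eq: "f a = (if even j then F a - j * M else Suc j * M - F a)"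
    if "a < n" "j * M \<le> F a" "F a \<le> Suc j * M" for a j
    using folds_to_eq[OF fold[OF that(1)] M that(2,3)] .
  have f0: "f 0 = 0" using f_eq[of 0 0] n F0 by simp
  have le: "f a \<le> M" if "a < n" for a using fold[OF that] by (simp add: folds_to_def)
  have M_le: "M \<le> F (n - 1)" using last k by simp
  have onto: "\<exists>a<n. F a = v \<and> f a = v" if v: "v \<le> M" for v
  proof -
    obtain a where "a \<le> n - 1" "F a = v"
      using slow_fun_IVT[OF F, of v "n - 1"] v M_le n by auto
    then show ?thesis using f_eq[of a 0] v n by (auto intro!: exI[of _ a])
  qed
  have step: "\<bar>int (f (Suc a)) - int (f a)\<bar> \<le> 1" if a: "Suc a < n" for a
  proof -
    consider "F (Suc a) = F a" | "F (Suc a) = Suc (F a)" using F a by (auto simp: slow_fun_def)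
    then show ?thesis
    proof cases
      case 1
      then have "f (Suc a) = f a"
        using folds_to_unique[OF fold[OF a] _ M, of "f a"] fold[of a] a by simp
      then show ?thesis by simp
    next
      case 2
      then show ?thesis using folds_to_Suc[of M "F a" "f a" "f (Suc a)"] fold[of a] fold[of "Suc a"] a M
        by auto
    qed
  qed
  have epi: "lg_epimorphism n (Suc M) f"
    unfolding lg_epimorphism_def
  proof (intro conjI)
    show "f ` lg_verts n = lg_verts (Suc M)"
      using le onto by (force simp: lg_verts_def less_Suc_eq_le)
    show "map_prod f f ` lg_edges n = lg_edges (Suc M)"
    proof
      show "map_prod f f ` lg_edges n \<subseteq> lg_edges (Suc M)"
      proof
        fix x assume "x \<in> map_prod f f ` lg_edges n"
        then obtain a b where x: "x = (f a, f b)" and ab: "a < n" "b < n" "\<bar>int a - int b\<bar> \<le> 1"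
          by (auto simp: lg_edges_def lg_verts_def)
        then have "a = b \<or> b = Suc a \<or> a = Suc b" by linarith
        then have "\<bar>int (f a) - int (f b)\<bar> \<le> 1"
          using step[of a] step[of b] ab by (auto simp: abs_minus_commute)
        then show "x \<in> lg_edges (Suc M)"
          using x ab le by (auto simp: lg_edges_def lg_verts_def less_Suc_eq_le)
      qed
      have refl: "(v, v) \<in> map_prod f f ` lg_edges n" if v: "v \<le> M" for v
      proof -
        obtain a where "a < n" "f a = v" using onto[OF v] by blast
        then show ?thesis by (intro image_eqI[of _ _ "(a, a)"]) (auto simp: lg_edges_def lg_verts_def)
      qed
      have next_edge: "(v, Suc v) \<in> map_prod f f ` lg_edges n \<and> (Suc v, v) \<in> map_prod f f ` lg_edges n"
        if v: "Suc v \<le> M" for v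
      proof -
        obtain a where a: "a < n" "F a = v" "\<And>b. a < b \<Longrightarrow> b < n \<Longrightarrow> v < F b"
          using slow_fun_last[OF F, of v] v M_le n by auto
        have "a \<noteq> n - 1" using a v M_le by auto
        then have a1: "Suc a < n" using a by simp
        then have Fa: "F (Suc a) = Suc v"
          using a(3)[of "Suc a"] a(2) F by (auto simp: slow_fun_def)
        have "f a = v" "f (Suc a) = Suc v"
          using f_eq[of a 0] f_eq[of "Suc a" 0] a a1 Fa v by auto
        then show ?thesis using a1
          by (auto intro: image_eqI[of _ _ "(a, Suc a)"] image_eqI[of _ _ "(Suc a, a)"]
              simp: lg_edges_def lg_verts_def)
      qed
      show "lg_edges (Suc M) \<subseteq> map_prod f f ` lg_edges n"
      proof
        fix x assume "x \<in> lg_edges (Suc M)"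
        then obtain v w where x: "x = (v, w)" "v \<le> M" "w \<le> M" "\<bar>int v - int w\<bar> \<le> 1"
          by (auto simp: lg_edges_def lg_verts_def less_Suc_eq_le)
        then have "v = w \<or> w = Suc v \<or> v = Suc w" by linarith
        then show "x \<in> map_prod f f ` lg_edges n"
          using x refl next_edge by auto
      qed
    qed
  qed (rule f0)
  \<comment> \<open>the first vertex above each multiple of \<open>M\<close>, except that the last leg is to include all the
      remaining vertices\<close>
  define i where "i j = (if j = k then n - 1 else LEAST a. F a = j * M)" for j
  have i: "i j < n \<and> F (i j) = j * M" if j: "j \<le> k" for j
  proof (cases "j = k")
    case True
    then show ?thesis using last n by (simp add: i_def)
  next
    case False
    have "j * M \<le> F (n - 1)" using last j by simp
    then obtain a where a: "a \<le> n - 1" "F a = j * M"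
      using slow_fun_IVT[OF F, of "j * M" "n - 1"] n by auto
    then have "(LEAST a. F a = j * M) \<le> a" "F (LEAST a. F a = j * M) = j * M"
      by (auto intro: Least_le LeastI)
    then show ?thesis using False a n by (auto simp: i_def)
  qed
  have i_less: "i j < i l" if "j < l" "l \<le> k" for j l
  proof (rule ccontr)
    assume "\<not> i j < i l"
    then have "F (i l) \<le> F (i j)"
      using slow_fun_mono[OF F, of "i l" "i j"] i[of j] that by simp
    then show False using i[of j] i[of l] that M by simp
  qed
  have leg: "mono_on {i j..i (Suc j)} f \<or> antimono_on {i j..i (Suc j)} f" if j: "j < k" for j
  proof -
    have bd: "a < n \<and> j * M \<le> F a \<and> F a \<le> Suc j * M" if "a \<in> {i j..i (Suc j)}" for a
      using slow_fun_mono[OF F, of "i j" a] slow_fun_mono[OF F, of a "i (Suc j)"] i[of j] i[of "Suc j"]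
        that j by auto
    have mono: "F a \<le> F b" if "a \<le> b" "b \<in> {i j..i (Suc j)}" for a b
      using slow_fun_mono[OF F that(1)] bd[OF that(2)] by simp
    show ?thesis
    proof (cases "even j")
      case True
      have "f a = F a - j * M" if "a \<in> {i j..i (Suc j)}" for a
        using f_eq[of a j] bd[OF that] True by simp
      then have "mono_on {i j..i (Suc j)} f"
        using mono by (intro monotone_onI) (auto intro: diff_le_mono)
      then show ?thesis ..
    next
      case False
      have "f a = Suc j * M - F a" if "a \<in> {i j..i (Suc j)}" for a
        using f_eq[of a j] bd[OF that] False by simp
      then have "antimono_on {i j..i (Suc j)} f"
        using mono by (intro monotone_onI) (auto intro: diff_le_mono2)
      then show ?thesis ..
    qed
  qed
  have ends: "f (i j) = (if odd j then Suc M - 1 else 0)" if "j \<le> k" for j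
    using f_eq[of "i j" j] i[OF that] by auto
  have "i 0 = 0"
    using k F0 by (auto simp: i_def intro: Least_equality)
  then show ?thesis
    unfolding lg_morphism_def lg_object_def
    using n M epi leg ends i_less
    by (intro conjI exI[of _ k] exI[of _ i]) (auto simp: strict_mono_on_def i_def)
qed

text \<open>The unfolding of a morphism is its total variation, since no step is longer than \<open>1\<close>.\<close>

lemma lg_morphismE:
  assumes "lg_morphism n m f"
  obtains k F where "1 \<le> k" "slow_fun n F" "F (n - 1) = k * (m - 1)"
    "\<And>a. a < n \<Longrightarrow> folds_to (m - 1) (F a) (f a)"
proof -
  define M where "M = m - 1"
  have n: "2 \<le> n" and m: "2 \<le> m" using assms by (auto simp: lg_morphism_def lg_object_def)
  have le: "f a \<le> M" if "a < n" for a
  proof -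
    have "f a \<in> lg_verts m"
      using assms that by (auto simp: lg_morphism_def lg_epimorphism_def lg_verts_def)
    then show ?thesis by (simp add: lg_verts_def M_def)
  qed
  have step: "\<bar>int (f (Suc a)) - int (f a)\<bar> \<le> 1" if "Suc a < n" for a
  proof -
    have "(Suc a, a) \<in> lg_edges n" using that by (simp add: lg_edges_def lg_verts_def)
    then have "map_prod f f (Suc a, a) \<in> lg_edges m"
      using assms unfolding lg_morphism_def lg_epimorphism_def by blast
    then show ?thesis by (simp add: lg_edges_def)
  qed
  from assms obtain k i where i: "strict_mono_on {..k} i" "i 0 = 0" "i k = n - 1"
    and leg: "\<And>j. j < k \<Longrightarrow> mono_on {i j..i (Suc j)} f \<or> antimono_on {i j..i (Suc j)} f"
    and ends: "\<And>j. j \<le> k \<Longrightarrow> f (i j) = (if odd j then M else 0)"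
    unfolding lg_morphism_def M_def by blast
  define F where "F a = (\<Sum>b<a. nat \<bar>int (f (Suc b)) - int (f b)\<bar>)" for a
  have F0: "F 0 = 0" and F_Suc: "F (Suc a) = F a + nat \<bar>int (f (Suc a)) - int (f a)\<bar>" for a
    by (simp_all add: F_def)
  have slow: "slow_fun n F"
    unfolding slow_fun_def
  proof (intro conjI allI impI)
    fix a assume "Suc a < n"
    then have "nat \<bar>int (f (Suc a)) - int (f a)\<bar> \<le> 1" using step[of a] by simp
    then show "F (Suc a) = F a \<or> F (Suc a) = Suc (F a)" unfolding F_Suc by linarith
  qed (rule F0)
  have i_less: "i j < i (Suc j)" if "j < k" for j
    using that by (intro strict_mono_onD[OF i(1)]) auto
  have F_leg: "F a = F (i j) + nat \<bar>int (f a) - int (f (i j))\<bar>"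
    if j: "j < k" and a: "i j \<le> a" "a \<le> i (Suc j)" for a j
    using a
  proof (induction a rule: dec_induct)
    case (step a)
    have mem: "i j \<in> {i j..i (Suc j)}" "a \<in> {i j..i (Suc j)}" "Suc a \<in> {i j..i (Suc j)}"
      using step by auto
    from leg[OF j] have "f (i j) \<le> f a \<and> f a \<le> f (Suc a) \<or> f a \<le> f (i j) \<and> f (Suc a) \<le> f a"
      using mem step.hyps by (meson le_SucI monotone_onD order_refl)
    then show ?case using step by (auto simp: F_Suc)
  qed simp
  have main: "F (i j) = j * M \<and> (\<forall>a\<le>i j. folds_to M (F a) (f a))" if "j \<le> k" for j
    using that
  proof (induction j)
    case 0
    then show ?case
      using ends[of 0] i(2) F0 by (auto simp: folds_to_def)
  next
    case (Suc j)
    then have IH: "F (i j) = j * M" "\<And>a. a \<le> i j \<Longrightarrow> folds_to M (F a) (f a)" and j: "j < k" by auto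
    have iS: "i (Suc j) < n"
    proof -
      have "i (Suc j) \<le> i k"
        using strict_mono_on_leD[OF i(1), of "Suc j" k] Suc.prems by simp
      then show ?thesis using i(3) n by simp
    qed
    have F_eq: "F a = j * M + (if even j then f a else M - f a)"
      if "i j \<le> a" "a \<le> i (Suc j)" for a
      using F_leg[OF j that] IH(1) ends[of j] j le[of a] that iS by auto
    have "folds_to M (F a) (f a)" if a: "a \<le> i (Suc j)" for a
    proof (cases "a \<le> i j")
      case False
      have "f a \<le> M" using le a iS by simp
      moreover have "F a = j * M + (if even j then f a else M - f a)"
        using F_eq[of a] a False by simp
      ultimately have "f a = (if even j then F a - j * M else Suc j * M - F a)"
        "j * M \<le> F a" "F a \<le> Suc j * M" by auto
      then show ?thesis using folds_toI[of j M "F a"] by simp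
    qed (rule IH(2))
    moreover have "F (i (Suc j)) = Suc j * M"
      using F_eq[of "i (Suc j)"] i_less[OF j] ends[of "Suc j"] Suc.prems by auto
    ultimately show ?case by blast
  qed
  have "k \<noteq> 0"
    using i(2,3) n by (cases k) auto
  show thesis
  proof (rule that[of k F])
    show "F (n - 1) = k * (m - 1)" using main[of k] i(3) by (simp add: M_def)
    show "folds_to (m - 1) (F a) (f a)" if "a < n" for a
      using main[of k] i(3) that by (simp add: M_def)
  qed (use slow \<open>k \<noteq> 0\<close> in auto)
qed

text \<open>
  The unfolding of \<open>g\<close> is extended from \<open>{0..M}\<close> to the half-line so that each further interval of
  length \<open>M\<close> is traversed like \<open>{0..M}\<close>, alternately backwards and forwards.
\<close>

lemma lg_morphism_compose:
  assumes f: "lg_morphism n m f" and g: "lg_morphism m l g"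
  shows "lg_morphism n l (\<lambda>a. g (f a))"
proof -
  define M where "M = m - 1"
  define L where "L = l - 1"
  have m: "m = Suc M" "1 \<le> M" and l: "l = Suc L" "1 \<le> L"
    using f g by (auto simp: lg_morphism_def lg_object_def M_def L_def)
  obtain k F where F: "1 \<le> k" "slow_fun n F" "F (n - 1) = k * M" "\<And>a. a < n \<Longrightarrow> folds_to M (F a) (f a)"
    using lg_morphismE[OF f] M_def by metis
  obtain k' G where G: "1 \<le> k'" "slow_fun m G" "G M = k' * L" "\<And>a. a \<le> M \<Longrightarrow> folds_to L (G a) (g a)"
    using lg_morphismE[OF g] m by (metis L_def diff_Suc_1 less_Suc_eq_le)
  have G0: "G 0 = 0" using G(2) by (simp add: slow_fun_def)
  have G_le: "G a \<le> k' * L" if "a \<le> M" for a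
    using slow_fun_mono[OF G(2) that] G(3) m by simp
  have G_step: "G (Suc a) = G a \<or> G (Suc a) = Suc (G a)" if "Suc a \<le> M" for a
    using G(2) that m by (simp add: slow_fun_def)
  define E where "E t = (t div M) * (k' * L) +
    (if even (t div M) then G (t mod M) else k' * L - G (M - t mod M))" for t
  have E_step: "E (Suc t) = E t \<or> E (Suc t) = Suc (E t)" for t
  proof (cases "Suc (t mod M) = M")
    case True
    then have "Suc t mod M = 0" "Suc t div M = Suc (t div M)" by (auto simp: mod_Suc div_Suc)
    moreover have "G M = G (M - 1) \<or> G M = Suc (G (M - 1))" "G 1 = G 0 \<or> G 1 = Suc (G 0)"
      using G_step[of "M - 1"] G_step[of 0] m by auto
    moreover have "t mod M = M - 1" "M - t mod M = 1" using True by auto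
    ultimately show ?thesis
      using G(3) G0 G_le[of 1] m by (auto simp: E_def)
  next
    case False
    then have "Suc t mod M = Suc (t mod M)" "Suc t div M = t div M"
      by (auto simp: mod_Suc div_Suc)
    moreover have lt: "t mod M < M" using m by simp
    moreover have "G (Suc (t mod M)) = G (t mod M) \<or> G (Suc (t mod M)) = Suc (G (t mod M))"
      using G_step lt by simp
    moreover have "M - t mod M = Suc (M - Suc (t mod M))" using lt by simp
    then have "G (M - t mod M) = G (M - Suc (t mod M)) \<or> G (M - t mod M) = Suc (G (M - Suc (t mod M)))"
      using G_step[of "M - Suc (t mod M)"] by simp
    moreover have "G (M - t mod M) \<le> k' * L" using G_le by simp
    ultimately show ?thesis by (auto simp: E_def)
  qed
  have E_fold: "folds_to L (E t) (g v)" if "folds_to M t v" for t v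
  proof -
    define q where "q = t div M"
    have t: "q * M \<le> t" "t \<le> Suc q * M" "t = q * M + t mod M" "t mod M < M"
      using div_bounds[OF m(2), of t] m unfolding q_def by auto
    have v: "v = (if even q then t mod M else M - t mod M)"
    proof -
      have "t - q * M = t mod M" "Suc q * M - t = M - t mod M"
        unfolding mult_Suc using t(3) by linarith+
      then show ?thesis using folds_to_eq[OF that m(2) t(1,2)] by simp
    qed
    then have vM: "v \<le> M" using t(4) by auto
    obtain c where c: "int (G v) = 2 * c * int L + int (g v) \<or> int (G v) = 2 * c * int L - int (g v)"
      and gL: "g v \<le> L"
      using G(4)[OF vM] by (auto simp: folds_to_def)
    show ?thesis
    proof (cases "even q")
      case True
      then obtain p where p: "q = 2 * p" by blast
      have "E t = q * (k' * L) + G v" using True v by (simp add: E_def q_def)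
      then have "int (E t) = 2 * int p * int k' * int L + int (G v)" by (simp add: p)
      then have "int (E t) = 2 * (int p * int k' + c) * int L + int (g v) \<or>
          int (E t) = 2 * (int p * int k' + c) * int L - int (g v)"
        using c by (auto simp: algebra_simps)
      then show ?thesis using gL unfolding folds_to_def by blast
    next
      case False
      then obtain p where p: "q = Suc (2 * p)" by (metis oddE Suc_eq_plus1)
      have "E t + G v = q * (k' * L) + k' * L"
        using False v G_le[OF vM] by (simp add: E_def q_def)
      then have "int (E t) + int (G v) = int q * (int k' * int L) + int k' * int L"
        by (metis of_nat_add of_nat_mult)
      then have "int (E t) = 2 * (int p + 1) * int k' * int L - int (G v)"
        by (simp add: p algebra_simps)
      then have "int (E t) = 2 * ((int p + 1) * int k' - c) * int L + int (g v) \<or>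
          int (E t) = 2 * ((int p + 1) * int k' - c) * int L - int (g v)"
        using c by (auto simp: algebra_simps)
      then show ?thesis using gL unfolding folds_to_def by blast
    qed
  qed
  have "lg_morphism n (Suc L) (\<lambda>a. g (f a))"
  proof (rule lg_morphismI[of n "\<lambda>a. E (F a)" "k * k'"])
    show "slow_fun n (\<lambda>a. E (F a))"
      unfolding slow_fun_def
    proof (intro conjI allI impI)
      show "E (F 0) = 0" using F(2) G0 m by (simp add: slow_fun_def E_def)
      fix a assume "Suc a < n"
      then have "F (Suc a) = F a \<or> F (Suc a) = Suc (F a)" using F(2) by (simp add: slow_fun_def)
      then show "E (F (Suc a)) = E (F a) \<or> E (F (Suc a)) = Suc (E (F a))"
        using E_step[of "F a"] by auto
    qed
    show "E (F (n - 1)) = k * k' * L"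
      using F(3) G0 G(3) m by (simp add: E_def)
    show "1 \<le> k * k'" using F(1) G(1) by simp
    show "folds_to L (E (F a)) (g (f a))" if "a < n" for a
      using E_fold F(4)[OF that] .
  qed (rule l)
  then show ?thesis by (simp add: l)
qed

lemma lg_morphism_id:
  assumes "2 \<le> n" shows "lg_morphism n n (\<lambda>a. a)"
proof -
  have "lg_morphism n (Suc (n - 1)) (\<lambda>a. a)"
    by (rule lg_morphismI[of n "\<lambda>a. a" 1])
      (use assms in \<open>auto simp: slow_fun_def folds_to_def intro: exI[of _ 0]\<close>)
  then show ?thesis using assms by simp
qed

section \<open>Discrete tent maps\<close>

lemma div_mod_block_end:
  fixes n :: nat
  assumes "1 \<le> n"
  shows "(Suc U * n - 1) div n = U" "(Suc U * n - 1) mod n = n - 1"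
proof -
  show div: "(Suc U * n - 1) div n = U"
    by (rule div_nat_eqI) (use assms in \<open>simp_all add: mult.commute\<close>)
  show "(Suc U * n - 1) mod n = n - 1"
    using minus_div_mult_eq_mod[of "Suc U * n - 1" n] unfolding div by simp
qed

text \<open>
  A slow function can be lifted along another one once it is slowed down so much that every value is
  kept for as long as the other function needs for running through the fibre over it.  On the
  block belonging to \<open>u\<close> the lift moves on from the end of the previous fibre until it reaches the
  end of the fibre over \<open>C u\<close>.
\<close>

lemma slow_fun_lift:
  assumes H: "slow_fun n H" and n: "1 \<le> n" and C: "slow_fun U C" and U: "1 \<le> U"
    and last: "C (U - 1) = H (n - 1)"
  obtains e where "slow_fun (U * n) e" "e (U * n - 1) = n - 1"
    "\<And>v. v < U * n \<Longrightarrow> e v < n \<and> H (e v) = C (v div n)"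
proof -
  define top where "top t = (GREATEST a. a < n \<and> H a = t)" for t
  have top: "top t < n \<and> H (top t) = t \<and> (\<forall>b. top t < b \<longrightarrow> b < n \<longrightarrow> t < H b)"
    if t: "t \<le> H (n - 1)" for t
  proof -
    obtain a where a: "a < n" "H a = t" "\<And>b. a < b \<Longrightarrow> b < n \<Longrightarrow> t < H b"
      using slow_fun_last[OF H t n] by blast
    have "top t = a"
      unfolding top_def
    proof (rule Greatest_equality)
      fix b assume "b < n \<and> H b = t"
      then show "b \<le> a" using a(3)[of b] by (auto simp: not_le[symmetric])
    qed (use a in simp)
    then show ?thesis using a by simp
  qed
  have Cle: "C u \<le> H (n - 1)" if "u < U" for u
    using slow_fun_mono[OF C, of u "U - 1"] that last by simp
  have C_step: "C (Suc u) = C u \<or> C (Suc u) = Suc (C u)" if "Suc u < U" for u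
    using C that by (simp add: slow_fun_def)
  define start where "start u = (if u = 0 then 0 else Suc (top (C (u - 1))))" for u
  define e where "e v = min (start (v div n) + v mod n) (top (C (v div n)))" for v
  have top_mono: "top (C u) \<le> top (C (Suc u))" if "Suc u < U" for u
  proof (rule ccontr)
    assume "\<not> ?thesis"
    then have "top (C (Suc u)) < top (C u)" by simp
    moreover have "top (C u) < n" "H (top (C u)) = C u" using top[OF Cle[of u]] that by auto
    ultimately have "C (Suc u) < C u" using top[OF Cle[OF that]] by metis
    then show False using C_step[OF that] by auto
  qed
  have div: "v div n < U" if "v < U * n" for v using that n by (simp add: div_less_iff_less_mult)
  have val: "e v < n \<and> H (e v) = C (v div n)" if v: "v < U * n" for v
  proof -
    let ?u = "v div n"
    have t: "top (C ?u) < n" "H (top (C ?u)) = C ?u" using top[OF Cle[OF div[OF v]]] by auto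
    show ?thesis
    proof (cases "start ?u \<le> top (C ?u)")
      case False
      then show ?thesis using t by (simp add: e_def)
    next
      case True
      have "C ?u \<le> H (start ?u)"
      proof (cases "?u = 0")
        case True
        then show ?thesis using C by (simp add: slow_fun_def)
      next
        case False
        then obtain u where u: "?u = Suc u" by (metis nat.exhaust)
        have uU: "Suc u < U" using div[OF v] u by simp
        have "C u < H (start ?u)"
          using top[OF Cle[of u]] True t uU by (simp add: start_def u)
        then show ?thesis using C_step[OF uU] u by auto
      qed
      moreover have ev: "start ?u \<le> e v" "e v \<le> top (C ?u)" "e v < n"
        using True t(1) by (auto simp: e_def)
      moreover have "H (start ?u) \<le> H (e v)" "H (e v) \<le> H (top (C ?u))"
        using slow_fun_mono[OF H] ev t(1) by blast+
      ultimately show ?thesis using t by simp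
    qed
  qed
  have "slow_fun (U * n) e"
    unfolding slow_fun_def
  proof (intro conjI allI impI)
    show "e 0 = 0" by (simp add: e_def start_def)
    fix v assume v: "Suc v < U * n"
    show "e (Suc v) = e v \<or> e (Suc v) = Suc (e v)"
    proof (cases "Suc (v mod n) = n")
      case True
      then have dm: "Suc v mod n = 0" "Suc v div n = Suc (v div n)" by (auto simp: mod_Suc div_Suc)
      have uU: "Suc (v div n) < U" using div[OF v] dm by simp
      have "top (C (v div n)) < n" using top[OF Cle[of "v div n"]] uU by simp
      then have "e v = top (C (v div n))" using True by (simp add: e_def min_def)
      then show ?thesis
        using top_mono[OF uU] by (auto simp: e_def dm start_def min_def)
    next
      case False
      then have "Suc v mod n = Suc (v mod n)" "Suc v div n = v div n" by (auto simp: mod_Suc div_Suc)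
      then show ?thesis by (auto simp: e_def min_def)
    qed
  qed
  moreover have "e (U * n - 1) = n - 1"
  proof -
    obtain U' where U': "U = Suc U'" using U by (metis Suc_le_D One_nat_def)
    have "(U * n - 1) div n = U'" "(U * n - 1) mod n = n - 1"
      unfolding U' by (rule div_mod_block_end[OF n])+
    moreover have "top (C U') = n - 1"
    proof -
      have "top (H (n - 1)) < n" "\<not> top (H (n - 1)) < n - 1"
        using top[of "H (n - 1)"] n by (auto dest: spec[of _ "n - 1"])
      then show ?thesis using last U' by simp
    qed
    ultimately show ?thesis by (simp add: e_def)
  qed
  ultimately show thesis using that val by blast
qed

text \<open>
  The vertex \<open>v\<close> of \<open>\<langle>b\<rangle>\<close> stands for the interval \<open>cell b v\<close>, so that adjacent vertices are those with
  intersecting intervals, and \<open>tent_vertex b\<close> is what a tent map does to the intervals.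
\<close>

definition cell :: "nat \<Rightarrow> nat \<Rightarrow> real set" where
  "cell b v = {real v / real b .. real (Suc v) / real b}"

definition tent_vertex :: "nat \<Rightarrow> nat \<Rightarrow> nat" where
  "tent_vertex b u = (if even (u div b) then u mod b else b - 1 - u mod b)"

text \<open>
  The unfolding of \<open>tent_vertex b\<close>.  It stands still from \<open>q * b - 1\<close> to \<open>q * b\<close>, since intervals on both sides of
  a turning point of the tent map have the same image, whereas the turning point of a morphism is a
  single vertex.
\<close>

definition tent_unfolded :: "nat \<Rightarrow> nat \<Rightarrow> nat" where
  "tent_unfolded b u = (u div b) * (b - 1) + u mod b"

lemma tent_vertex_less: "1 \<le> b \<Longrightarrow> tent_vertex b u < b"
  by (auto simp: tent_vertex_def)

lemma folds_to_tent_vertex: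
  assumes "1 \<le> b" shows "folds_to (b - 1) (tent_unfolded b u) (tent_vertex b u)"
proof -
  have "u mod b \<le> b - 1" using assms by (simp add: Suc_le_D less_Suc_eq_le[symmetric])
  then show ?thesis
    using folds_toI[of "u div b" "b - 1" "tent_unfolded b u"]
    by (simp add: tent_unfolded_def tent_vertex_def split: if_splits)
qed

lemma slow_fun_tent_unfolded:
  assumes "1 \<le> b" shows "slow_fun U (tent_unfolded b)"
  unfolding slow_fun_def
proof (intro conjI allI impI)
  fix u
  show "tent_unfolded b (Suc u) = tent_unfolded b u \<or> tent_unfolded b (Suc u) = Suc (tent_unfolded b u)"
    by (auto simp: tent_unfolded_def mod_Suc div_Suc)
qed (simp add: tent_unfolded_def)

lemma tent_unfolded_last:
  assumes "1 \<le> b" "1 \<le> k" shows "tent_unfolded b (b * k - 1) = k * (b - 1)"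
proof -
  obtain k' where k: "k = Suc k'" using assms(2) by (metis Suc_le_D One_nat_def)
  have "(b * k - 1) div b = k'" "(b * k - 1) mod b = b - 1"
    unfolding k mult.commute[of b] by (rule div_mod_block_end[OF assms(1)])+
  then show ?thesis by (simp add: tent_unfolded_def k)
qed

lemma slow_fun_div:
  assumes "slow_fun U C" "1 \<le> n" shows "slow_fun (U * n) (\<lambda>v. C (v div n))"
  unfolding slow_fun_def
proof (intro conjI allI impI)
  fix v assume "Suc v < U * n"
  then have "Suc v div n < U" using assms(2) by (simp add: div_less_iff_less_mult)
  then show "C (Suc v div n) = C (v div n) \<or> C (Suc v div n) = Suc (C (v div n))"
    using assms(1) by (auto simp: slow_fun_def div_Suc split: if_splits)
qed (use assms in \<open>simp add: slow_fun_def\<close>)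

lemma lg_morphism_tent_vertex:
  assumes "2 \<le> b" "1 \<le> k" "1 \<le> n"
  shows "lg_morphism (b * k * n) b (\<lambda>v. tent_vertex b (v div n))"
proof -
  have "(b * k * n - 1) div n = b * k - 1"
  proof -
    obtain U where U: "b * k = Suc U" using assms by (cases "b * k") auto
    then show ?thesis using div_mod_block_end(1)[OF assms(3), of U] by simp
  qed
  then have "lg_morphism (b * k * n) (Suc (b - 1)) (\<lambda>v. tent_vertex b (v div n))"
    using assms by (intro lg_morphismI[of _ "\<lambda>v. tent_unfolded b (v div n)" k] slow_fun_div
        slow_fun_tent_unfolded folds_to_tent_vertex) (auto simp: tent_unfolded_last[simplified])
  then show ?thesis using assms by simp
qed

lemma tent_cell:
  assumes "1 \<le> b" "1 \<le> k" "1 \<le> n" and x: "x \<in> cell (b * k * n) v"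
  shows "tent k x \<in> cell b (tent_vertex b (v div n))"
proof -
  define u where "u = v div n"
  define q where "q = u div b"
  define r where "r = u mod b"
  have u: "u = q * b + r" and r: "Suc r \<le> b" using assms(1) by (auto simp: q_def r_def Suc_le_eq)
  have "u * n \<le> v" "Suc v \<le> Suc u * n"
    using div_bounds[OF assms(3), of v] by (auto simp: u_def)
  then have "real u * real n \<le> real v" "real (Suc v) \<le> real (Suc u) * real n"
    by (metis of_nat_le_iff of_nat_mult)+
  moreover have pos: "0 < real b" "0 < real k" "0 < real n" using assms by auto
  moreover have "real v \<le> x * (real b * real k) * real n" "x * (real b * real k) * real n \<le> real (Suc v)"
    using x pos by (simp_all add: cell_def pos_divide_le_eq pos_le_divide_eq mult.assoc)
  ultimately have "real u * real n \<le> x * (real b * real k) * real n"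
      "x * (real b * real k) * real n \<le> real (Suc u) * real n"
    by linarith+
  then have "real u \<le> x * (real b * real k)" "x * (real b * real k) \<le> real (Suc u)"
    using pos(3) by (simp_all only: mult_le_cancel_right_pos)
  then have 1: "real u / b \<le> k * x" "k * x \<le> real (Suc u) / b"
    using pos by (auto simp: field_simps)
  define y where "y = k * x - q"
  have y: "real r / b \<le> y" "y \<le> real (Suc r) / b"
    using 1 pos by (auto simp: y_def u field_simps)
  have "0 \<le> real r / b" "real (Suc r) / b \<le> 1" using r pos by (auto simp: field_simps)
  then have y01: "0 \<le> y" "y \<le> 1" using y by linarith+
  show ?thesis
  proof (cases "even q")
    case True
    then obtain p where "q = 2 * p" by blast
    then have "tent k x = y"
      using y01 by (intro tent_eqI[of _ _ _ "int p"]) (auto simp: y_def)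
    then show ?thesis
      using True y by (simp add: cell_def tent_vertex_def flip: u_def q_def r_def)
  next
    case False
    then obtain p where "q = Suc (2 * p)" by (metis oddE Suc_eq_plus1)
    then have "tent k x = 1 - y"
      using y01 by (intro tent_eqI[of _ _ _ "int p + 1"]) (auto simp: y_def)
    moreover have "real (b - 1 - r) = real b - 1 - real r" "real (Suc (b - 1 - r)) = real b - real r"
      using r by auto
    then have "1 - y \<in> cell b (b - 1 - r)"
      using y pos by (auto simp: cell_def field_simps)
    ultimately show ?thesis
      using False by (simp add: tent_vertex_def flip: u_def q_def r_def)
  qed
qed

text \<open>
  Every morphism \<open>h\<close> becomes a discrete tent map after composition with a suitable morphism \<open>e\<close>,
  which moreover can be chosen such that the degree is a multiple of a given number: lift the discrete
  tent map whose degree is that of \<open>h\<close> along \<open>h\<close>, and precompose with a discrete tent map of the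
  given degree.
\<close>

lemma lg_morphism_refine_to_tent:
  assumes h: "lg_morphism n b h" and s: "1 \<le> s"
  obtains b' e d where "lg_morphism b' n e" "1 \<le> d" "s dvd d" "2 * (b * d) \<le> b'"
    "\<And>v. v < b' \<Longrightarrow> tent d ` cell b' v \<subseteq> cell b (h (e v))"
proof -
  have n: "2 \<le> n" and b: "2 \<le> b" using h by (auto simp: lg_morphism_def lg_object_def)
  obtain k H where H: "1 \<le> k" "slow_fun n H" "H (n - 1) = k * (b - 1)"
    "\<And>a. a < n \<Longrightarrow> folds_to (b - 1) (H a) (h a)"
    using lg_morphismE[OF h] by blast
  obtain e0 where e0: "slow_fun (b * k * n) e0" "e0 (b * k * n - 1) = n - 1"
    "\<And>v. v < b * k * n \<Longrightarrow> e0 v < n \<and> H (e0 v) = tent_unfolded b (v div n)"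
    using slow_fun_lift[OF H(2) _ slow_fun_tent_unfolded[of b "b * k"]] n b H(1,3)
    by (auto simp: tent_unfolded_last[simplified])
  have he0: "h (e0 v) = tent_vertex b (v div n)" if v: "v < b * k * n" for v
  proof (rule folds_to_unique)
    show "folds_to (b - 1) (tent_unfolded b (v div n)) (h (e0 v))"
      using H(4)[of "e0 v"] e0(3)[OF v] by simp
    show "folds_to (b - 1) (tent_unfolded b (v div n)) (tent_vertex b (v div n))"
      by (rule folds_to_tent_vertex) (use b in simp)
  qed (use b in simp)
  have "lg_morphism (b * k * n) (Suc (n - 1)) e0"
  proof (rule lg_morphismI[OF e0(1), of 1])
    fix v assume "v < b * k * n"
    then have "e0 v \<le> n - 1" using e0(3)[of v] by auto
    then show "folds_to (n - 1) (e0 v) (e0 v)"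
      by (auto simp: folds_to_def intro: exI[of _ 0])
  qed (use e0(2) n in auto)
  then have e0_mor: "lg_morphism (b * k * n) n e0" using n by simp
  define b0 where "b0 = b * k * n"
  have b0: "2 \<le> b0"
  proof -
    have "2 * (1 * 1) \<le> b * (k * n)" using b H(1) n by (intro mult_mono) auto
    then show ?thesis by (simp add: b0_def mult.assoc)
  qed
  have c: "lg_morphism (b0 * s * 2) b0 (\<lambda>v. tent_vertex b0 (v div 2))"
    using lg_morphism_tent_vertex[OF b0 s, of 2] by simp
  show thesis
  proof (rule that)
    show "lg_morphism (b0 * s * 2) n (\<lambda>v. e0 (tent_vertex b0 (v div 2)))"
      using lg_morphism_compose[OF c] e0_mor by (simp add: b0_def)
    show "1 \<le> k * s" "s dvd k * s" using H(1) s by auto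
    have "b * (k * s) * 1 \<le> b * (k * s) * n" using n by (intro mult_le_mono2) simp
    then show "2 * (b * (k * s)) \<le> b0 * s * 2" by (simp add: b0_def mult_ac)
    fix v
    show "tent (k * s) ` cell (b0 * s * 2) v \<subseteq> cell b (h (e0 (tent_vertex b0 (v div 2))))"
    proof (rule image_subsetI)
      fix x assume "x \<in> cell (b0 * s * 2) v"
      then have "tent s x \<in> cell b0 (tent_vertex b0 (v div 2))"
        using tent_cell[of b0 s 2 x v] b0 s by simp
      moreover have "tent_vertex b0 (v div 2) < b0" using tent_vertex_less b0 by simp
      ultimately have "tent k (tent s x) \<in> cell b (h (e0 (tent_vertex b0 (v div 2))))"
        using tent_cell[of b k n "tent s x"] b H(1) n he0 by (simp add: b0_def)
      then show "tent (k * s) x \<in> cell b (h (e0 (tent_vertex b0 (v div 2))))"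
        by (simp add: tent_tent)
    qed
  qed
qed

section \<open>Inverse limits of finite linear graphs\<close>

lemma lg_morphism_verts: "lg_morphism n m f \<Longrightarrow> f ` {..<n} = {..<m}"
  by (simp add: lg_morphism_def lg_epimorphism_def lg_verts_def)

lemma lg_morphism_edge:
  assumes "lg_morphism n m f" "(v, w) \<in> lg_edges n" shows "(f v, f w) \<in> lg_edges m"
proof -
  have "map_prod f f ` lg_edges n = lg_edges m"
    using assms(1) by (simp add: lg_morphism_def lg_epimorphism_def)
  then show ?thesis using assms(2) by force
qed

lemma lg_edges_iff: "(v, w) \<in> lg_edges n \<longleftrightarrow> v < n \<and> w < n \<and> v \<le> Suc w \<and> w \<le> Suc v"
  by (auto simp: lg_edges_def lg_verts_def)

lemma topspace_tg_topology: "topspace (tg_topology L) = tg_carrier L"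
  by (simp add: tg_topology_def topspace_inv_limit tg_carrier_def)

lemma tg_carrier_less: "x \<in> tg_carrier L \<Longrightarrow> x n < fst L n"
  by (auto simp: tg_carrier_def inv_limit_set_def lg_verts_def)

lemma tg_const_carrier: "x \<in> tg_carrier (tg_const A) \<longleftrightarrow> (\<forall>n. x n < A) \<and> (\<forall>n. x (Suc n) = x n)"
  by (auto simp: tg_carrier_def tg_const_def inv_limit_set_def lg_verts_def)

lemma continuous_map_tg_coord:
  "continuous_map (tg_topology L) (discrete_topology {..<fst L n}) (\<lambda>x. x n)"
  using continuous_map_inv_limit_coord[of "\<lambda>n. discrete_topology (lg_verts (fst L n))" "snd L" n]
  by (simp add: tg_topology_def lg_verts_def)

lemma compact_space_tg_topology:
  assumes "tg_object L" shows "compact_space (tg_topology L)"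
  unfolding tg_topology_def
proof (rule compact_space_inv_limit)
  show "continuous_map (discrete_topology (lg_verts (fst L (Suc n))))
      (discrete_topology (lg_verts (fst L n))) (snd L n)" for n
    using assms lg_morphism_verts by (fastforce simp: tg_object_def lg_verts_def)
qed (simp_all add: lg_verts_def compact_space_discrete_topology)

lemma tg_coord_surj:
  assumes "tg_object L" "v < fst L n"
  obtains x where "x \<in> tg_carrier L" "x n = v"
  using inv_limit_set_coord_surj[of "snd L" "\<lambda>n. {..<fst L n}" v n] assms lg_morphism_verts
  by (auto simp: tg_carrier_def lg_verts_def tg_object_def)

lemma tg_bonding_composite:
  assumes "tg_object L"
  shows "\<exists>f. lg_morphism (fst L (n + i)) (fst L n) f \<and> (\<forall>x\<in>tg_carrier L. f (x (n + i)) = x n)"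
proof (induction i)
  case 0
  have "2 \<le> fst L n" using assms by (simp add: tg_object_def lg_object_def)
  then show ?case using lg_morphism_id by (intro exI[of _ "\<lambda>a. a"]) auto
next
  case (Suc i)
  then obtain f where f: "lg_morphism (fst L (n + i)) (fst L n) f" "\<forall>x\<in>tg_carrier L. f (x (n + i)) = x n"
    by blast
  have g: "lg_morphism (fst L (Suc (n + i))) (fst L (n + i)) (snd L (n + i))"
    using assms by (simp add: tg_object_def)
  show ?case
    using lg_morphism_compose[OF g f(1)] f(2)
    by (intro exI[of _ "\<lambda>a. f (snd L (n + i) a)"]) (auto simp: tg_carrier_def inv_limit_set_def)
qed

lemma tg_object_const: "2 \<le> A \<Longrightarrow> tg_object (tg_const A)"
  using lg_morphism_id by (simp add: tg_object_def tg_const_def lg_object_def)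

lemma tg_morphism_proj:
  assumes "tg_object L" shows "tg_morphism L (tg_const (fst L n)) (\<lambda>x _. x n)"
proof -
  have "2 \<le> fst L n" using assms by (simp add: tg_object_def lg_object_def)
  moreover obtain f where "\<And>i. lg_morphism (fst L (n + i)) (fst L n) (f i)"
      "\<And>i x. x \<in> tg_carrier L \<Longrightarrow> f i (x (n + i)) = x n"
    using tg_bonding_composite[OF assms, of n] by metis
  ultimately show ?thesis
    unfolding tg_morphism_def using assms tg_object_const
    by (intro conjI exI[of _ "\<lambda>i. n + i"] exI[of _ f])
      (auto simp: tg_const_carrier tg_carrier_less strict_mono_def, auto simp: tg_const_def)
qed

lemma tg_morphism_const:
  assumes "lg_morphism B A g"
  shows "tg_morphism (tg_const B) (tg_const A) (\<lambda>x k. g (x k))"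
proof -
  have "2 \<le> A" "2 \<le> B" using assms by (auto simp: lg_morphism_def lg_object_def)
  then show ?thesis
    unfolding tg_morphism_def using assms tg_object_const lg_morphism_verts[OF assms]
    by (intro conjI exI[of _ "\<lambda>i. i"] exI[of _ "\<lambda>i. g"])
      (auto simp: tg_const_carrier strict_mono_def, auto simp: tg_const_def)
qed

text \<open>
  The extension property is applied to a coordinate projection.  The lift that it provides factors
  through some coordinate of \<open>K\<close>, which can be taken beyond \<open>n\<close>.
\<close>

lemma projective_Fraisse_limit_absorb:
  assumes K: "projective_Fraisse_limit K" and g: "lg_morphism B (fst K n) g"
  obtains m h where "n < m" "lg_morphism (fst K m) B h" "\<And>x. x \<in> tg_carrier K \<Longrightarrow> g (h (x m)) = x n"
proof -
  have obj: "tg_object K" using K by (simp add: projective_Fraisse_limit_def)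
  have "lg_object B" "lg_object (fst K n)" using g by (auto simp: lg_morphism_def)
  then obtain \<psi> where \<psi>: "tg_morphism K (tg_const B) \<psi>"
      "\<forall>x\<in>tg_carrier K. (\<lambda>k. g (\<psi> x k)) = (\<lambda>k. x n)"
    using K tg_morphism_proj[OF obj, of n] tg_morphism_const[OF g]
    unfolding projective_Fraisse_limit_def by blast
  from \<psi>(1) have "\<exists>i \<phi>. strict_mono i \<and> (\<forall>k. lg_morphism (fst K (i k)) B (\<phi> k)) \<and>
      (\<forall>k. \<forall>x\<in>tg_carrier K. \<psi> x k = \<phi> k (x (i k)))"
    by (simp add: tg_morphism_def tg_const_def)
  then obtain i \<phi> where i: "strict_mono i" "\<And>k. lg_morphism (fst K (i k)) B (\<phi> k)"
      "\<And>k x. x \<in> tg_carrier K \<Longrightarrow> \<psi> x k = \<phi> k (x (i k))"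
    by blast
  show thesis
  proof (rule that[of "i (Suc n)" "\<phi> (Suc n)"])
    show "n < i (Suc n)" using strict_mono_imp_increasing[OF i(1), of "Suc n"] by simp
    show "g (\<phi> (Suc n) (x (i (Suc n)))) = x n" if "x \<in> tg_carrier K" for x
      using \<psi>(2) that i(3)[OF that] by (metis (no_types, lifting))
  qed (rule i(2))
qed

text \<open>
  Back and forth between the given sequence and one whose bonding maps are discrete tent maps:
  \<open>h\<close> leads from the given sequence to the new graphs \<open>\<langle>b j\<rangle>\<close> and \<open>e\<close> leads back.  The
  composites \<open>e \<circ> h\<close> are bonding maps by the extension property, the composites \<open>h \<circ> e\<close> are discrete
  tent maps by the choice of \<open>e\<close>.
\<close>

lemma projective_Fraisse_limit_tent_sequence:
  assumes K: "projective_Fraisse_limit K"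
  obtains N b d :: "nat \<Rightarrow> nat" and h e :: "nat \<Rightarrow> nat \<Rightarrow> nat" where
    "strict_mono N" "\<And>j. lg_morphism (fst K (N j)) (b j) (h j)"
    "\<And>j. lg_morphism (b (Suc j)) (fst K (N j)) (e j)"
    "\<And>j x. x \<in> tg_carrier K \<Longrightarrow> e j (h (Suc j) (x (N (Suc j)))) = x (N j)"
    "\<And>j. 1 \<le> d j" "\<And>j. Suc j dvd d j" "\<And>j. 2 * (b j * d j) \<le> b (Suc j)"
    "\<And>j v. v < b (Suc j) \<Longrightarrow> tent (d j) ` cell (b (Suc j)) v \<subseteq> cell (b j) (h j (e j v))"
proof -
  have obj: "tg_object K" using K by (simp add: projective_Fraisse_limit_def)
  define P where "P j s = (case s of (n, b, h) \<Rightarrow> lg_morphism (fst K n) b h)"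
    for j :: nat and s :: "nat \<times> nat \<times> (nat \<Rightarrow> nat)"
  define R where "R j s s' e d = (case s of (n, b, h) \<Rightarrow> case s' of (n', b', h') \<Rightarrow>
      n < n' \<and> lg_morphism b' (fst K n) e \<and> (\<forall>x\<in>tg_carrier K. e (h' (x n')) = x n) \<and>
      1 \<le> d \<and> Suc j dvd d \<and> 2 * (b * d) \<le> b' \<and>
      (\<forall>v<b'. tent d ` cell b' v \<subseteq> cell b (h (e v))))"
    for j d :: nat and s s' :: "nat \<times> nat \<times> (nat \<Rightarrow> nat)" and e
  have "\<exists>s. \<forall>j. P j (s j) \<and> (\<exists>e d. R j (s j) (s (Suc j)) e d)"
  proof (rule dependent_nat_choice[of P "\<lambda>j s s'. \<exists>e d. R j s s' e d"])
    have "2 \<le> fst K 0" using obj by (simp add: tg_object_def lg_object_def)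
    then show "\<exists>s. P 0 s"
      using lg_morphism_id by (intro exI[of _ "(0, fst K 0, \<lambda>a. a)"]) (simp add: P_def)
    fix s j assume "P j s"
    then obtain n b h where s: "s = (n, b, h)" and h: "lg_morphism (fst K n) b h"
      by (cases s) (auto simp: P_def)
    obtain b' e d where e: "lg_morphism b' (fst K n) e" "1 \<le> d" "Suc j dvd d" "2 * (b * d) \<le> b'"
        "\<And>v. v < b' \<Longrightarrow> tent d ` cell b' v \<subseteq> cell b (h (e v))"
      using lg_morphism_refine_to_tent[OF h, of "Suc j"] by auto
    obtain n' h' where h': "n < n'" "lg_morphism (fst K n') b' h'"
        "\<And>x. x \<in> tg_carrier K \<Longrightarrow> e (h' (x n')) = x n"
      using projective_Fraisse_limit_absorb[OF K e(1)] by blast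
    have "P (Suc j) (n', b', h')" using h' by (simp add: P_def)
    moreover have "R j s (n', b', h') e d" using e h' by (simp add: R_def s)
    ultimately show "\<exists>s'. P (Suc j) s' \<and> (\<exists>e d. R j s s' e d)" by blast
  qed
  then obtain s where s: "\<And>j. P j (s j)" "\<And>j. \<exists>e d. R j (s j) (s (Suc j)) e d" by blast
  then obtain e d where R: "\<And>j. R j (s j) (s (Suc j)) (e j) (d j)" by metis
  define N where "N j = fst (s j)" for j
  define b where "b j = fst (snd (s j))" for j
  define h where "h j = snd (snd (s j))" for j
  have sj: "s j = (N j, b j, h j)" for j by (simp add: N_def b_def h_def)
  note R' = R[unfolded R_def sj prod.case]
  show thesis
  proof (rule that[of N b h e d])
    show "strict_mono N" using R' by (simp add: strict_mono_Suc_iff)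
    show "lg_morphism (fst K (N j)) (b j) (h j)" for j using s(1)[of j] by (simp add: P_def sj)
  qed (use R' in blast)+
qed

section \<open>The quotient of the limit\<close>

lemma cell_dist:
  assumes "s \<in> cell b v" "t \<in> cell b w" "v \<le> Suc w" "w \<le> Suc v"
  shows "\<bar>s - t\<bar> \<le> 2 / real b"
proof -
  have "real (Suc v) / b \<le> real w / b + 2 / b" "real (Suc w) / b \<le> real v / b + 2 / b"
    using assms(3,4) by (simp_all add: divide_right_mono flip: add_divide_distrib)
  then show ?thesis using assms(1,2) unfolding cell_def atLeastAtMost_iff by linarith
qed

lemma cells_meet:
  assumes "t \<in> cell b v" "t \<in> cell b w" "1 \<le> b" shows "v \<le> Suc w"
proof -
  have "real v / b \<le> real (Suc w) / b" using assms(1,2) by (auto simp: cell_def)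
  then have "real v \<le> real (Suc w)" using assms(3) by (simp add: divide_le_cancel)
  then show ?thesis by linarith
qed

lemma cell_subset: "v < b \<Longrightarrow> cell b v \<subseteq> {0..1}"
  by (auto simp: cell_def field_simps)

lemma closedin_cell: "v < b \<Longrightarrow> closedin unit_interval (cell b v)"
  by (rule closed_subset[OF cell_subset]) (simp_all add: cell_def)

lemma cells_cover:
  assumes "t \<in> {0..1}" "1 \<le> b" obtains v where "v < b" "t \<in> cell b v"
proof (cases "t = 1")
  case True
  then show thesis using that[of "b - 1"] assms by (auto simp: cell_def field_simps)
next
  case False
  define v where "v = nat \<lfloor>t * b\<rfloor>"
  have "0 \<le> t * b" "t * b < b" using assms False by auto
  then have "real v \<le> t * b" "t * b < real (Suc v)" "v < b"
    unfolding v_def by linarith+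
  then show thesis using that[of v] assms by (auto simp: cell_def field_simps)
qed

text \<open>
  The tent map from the coordinate \<open>m\<close> to the coordinate \<open>n\<close> expands by the product of the degrees, but the
  intervals of level \<open>m\<close> are shorter than those of level \<open>n\<close> by at least this factor times \<open>2 ^ (m - n)\<close>.
\<close>

lemma tent_limit_contraction:
  fixes b d :: "nat \<Rightarrow> nat"
  assumes b: "\<And>j. 1 \<le> b j" "\<And>j. 2 * (b j * d j) \<le> b (Suc j)"
    and u: "u \<in> topspace (tent_limit d)" "u' \<in> topspace (tent_limit d)"
    and le: "n \<le> m" and close: "\<bar>u m - u' m\<bar> \<le> c / b m" and c: "0 \<le> c"
  shows "\<bar>u n - u' n\<bar> \<le> c / 2 ^ (m - n)"
proof -
  define D where "D = (\<Prod>j\<in>{n..<m}. d j)"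
  have "2 ^ (m - n) * (b n * (\<Prod>j\<in>{n..<m}. d j)) \<le> b m"
    using le
  proof (induction m rule: dec_induct)
    case (step m)
    have "2 ^ (Suc m - n) * (b n * (\<Prod>j\<in>{n..<Suc m}. d j)) =
        2 * ((2 ^ (m - n) * (b n * (\<Prod>j\<in>{n..<m}. d j))) * d m)"
      using step.hyps by (simp add: prod.atLeastLessThan_Suc Suc_diff_le)
    also have "\<dots> \<le> 2 * (b m * d m)"
      using step.IH by (intro mult_le_mono2 mult_le_mono1)
    also have "\<dots> \<le> b (Suc m)" by (rule b)
    finally show ?case .
  qed simp
  moreover have "2 ^ (m - n) * (1 * D) \<le> 2 ^ (m - n) * (b n * D)"
    by (intro mult_le_mono2 mult_le_mono1 b)
  ultimately have "2 ^ (m - n) * D \<le> b m"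
    unfolding D_def by (metis le_trans mult_1)
  then have "real (2 ^ (m - n) * D) \<le> real (b m)" by (simp only: of_nat_le_iff)
  then have D: "2 ^ (m - n) * real D \<le> real (b m)" by simp
  have "\<bar>u n - u' n\<bar> = \<bar>tent D (u m) - tent D (u' m)\<bar>"
    using inv_limit_tent_power[of _ "\<lambda>n. {0..1}" d n m] u le by (simp add: topspace_tent_limit D_def)
  also have "\<dots> \<le> D * \<bar>u m - u' m\<bar>" by (rule tent_Lipschitz)
  also have "\<dots> \<le> D * (c / b m)" by (intro mult_left_mono close) simp
  also have "\<dots> \<le> c / 2 ^ (m - n)"
  proof -
    have "(2 ^ (m - n) * real D) * c \<le> real (b m) * c" by (intro mult_right_mono D c)
    then show ?thesis using b(1)[of m] by (simp add: field_simps)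
  qed
  finally show ?thesis .
qed

lemma tent_limit_eqI:
  fixes b d :: "nat \<Rightarrow> nat"
  assumes b: "\<And>j. 1 \<le> b j" "\<And>j. 2 * (b j * d j) \<le> b (Suc j)"
    and u: "u \<in> topspace (tent_limit d)" "u' \<in> topspace (tent_limit d)"
    and close: "\<And>m. \<bar>u m - u' m\<bar> \<le> 2 / b m"
  shows "u = u'"
proof
  fix n
  have "\<bar>u n - u' n\<bar> \<le> 2 * (1 / 2) ^ k" for k
    using tent_limit_contraction[OF b u le_add1[of n k] close[of "n + k"]]
    by (simp add: power_one_over)
  moreover have lim: "(\<lambda>k. 2 * (1 / 2) ^ k) \<longlonglongrightarrow> 2 * (0::real)"
    by (intro tendsto_intros LIMSEQ_power_zero) simp
  ultimately have "\<bar>u n - u' n\<bar> \<le> 2 * 0" by (intro LIMSEQ_le_const[OF lim]) blast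
  then show "u n = u' n" by simp
qed

theorem proposition4p3:
  fixes K :: tg
  assumes "projective_Fraisse_limit K"
  shows "equiv (tg_carrier K) (tg_rel K) \<and>
    (\<exists>U. universal_Knaster_continuum U \<and>
         quotient_space (tg_topology K) (tg_rel K) homeomorphic_space U)"
proof -
  let ?C = "tg_carrier K"
  have obj: "tg_object K" using assms by (simp add: projective_Fraisse_limit_def)
  obtain N b d h e where N: "strict_mono N" and h: "\<And>j. lg_morphism (fst K (N j)) (b j) (h j)"
    and e: "\<And>j. lg_morphism (b (Suc j)) (fst K (N j)) (e j)"
    and eh: "\<And>j x. x \<in> ?C \<Longrightarrow> e j (h (Suc j) (x (N (Suc j)))) = x (N j)"
    and d: "\<And>j. (1::nat) \<le> d j" "\<And>j. Suc j dvd d j" and bd: "\<And>j. 2 * (b j * d j) \<le> b (Suc j)"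
    and tc: "\<And>j v. v < b (Suc j) \<Longrightarrow> tent (d j) ` cell (b (Suc j)) v \<subseteq> cell (b j) (h j (e j v))"
    using projective_Fraisse_limit_tent_sequence[OF assms] by metis
  have b1: "1 \<le> b j" for j using h[of j] by (simp add: lg_morphism_def lg_object_def)
  \<comment> \<open>the thread of intervals that belongs to a point of \<open>K\<close>\<close>
  let ?U = "tent_limit d"
  define y where "y j x = h j (x (N j))" for j x
  have y_less: "y j x < b j" if "x \<in> ?C" for j x
    using lg_morphism_verts[OF h[of j]] tg_carrier_less[OF that, of "N j"] by (auto simp: y_def)
  have y_tent: "tent (d j) t \<in> cell (b j) (y j x)"
    if "x \<in> ?C" "t \<in> cell (b (Suc j)) (y (Suc j) x)" for j x t
    using tc[OF y_less[OF that(1), of "Suc j"]] eh[OF that(1), of j] that(2)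
    by (auto simp: y_def image_subset_iff)

  have U_step: "tent (d j) (u (Suc j)) = u j" "u j \<in> {0..1}" if "u \<in> topspace ?U" for u j
    using inv_limit_setD[OF that[unfolded topspace_tent_limit]] by blast+

  have "\<exists>u. u \<in> topspace ?U \<and> (\<forall>j. u j \<in> cell (b j) (y j x))" if x: "x \<in> ?C" for x
  proof -
    define F where "F j = {u \<in> topspace ?U. u j \<in> cell (b j) (y j x)}" for j
    obtain u where "u \<in> topspace ?U" "\<And>j. u \<in> F j"
    proof (rule compact_space_nested_closed[OF compact_space_tent_limit])
      show "closedin ?U (F j)" for j
        unfolding F_def
        by (rule closedin_continuous_map_preimage[OF continuous_map_tent_limit_coord closedin_cell])
          (rule y_less[OF x])
      show "F j \<noteq> {}" for j
      proof -
        define t where "t = real (y j x) / b j"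
        have "t \<in> cell (b j) (y j x)" by (simp add: t_def cell_def divide_right_mono)
        moreover have "t \<in> {0..1}" using cell_subset[OF y_less[OF x]] calculation by blast
        moreover have "\<exists>u\<in>inv_limit_set (\<lambda>n. {0..1}) (\<lambda>n. tent (d n)). u j = t"
          by (rule inv_limit_set_coord_surj) (use tent_onto[OF d(1)] \<open>t \<in> {0..1}\<close> in auto)
        ultimately show ?thesis by (auto simp: F_def topspace_tent_limit)
      qed
      show "F (Suc j) \<subseteq> F j" for j
        using y_tent[OF x] U_step(1) by (auto simp: F_def) metis
    qed blast
    then show ?thesis by (auto simp: F_def)
  qed
  then obtain \<sigma> where \<sigma>U: "\<And>x. x \<in> ?C \<Longrightarrow> \<sigma> x \<in> topspace ?U"
    and \<sigma>: "\<And>x j. x \<in> ?C \<Longrightarrow> \<sigma> x j \<in> cell (b j) (y j x)" by metis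

  have "continuous_map (tg_topology K) ?U \<sigma>"
    unfolding tent_limit_def
  proof (rule continuous_map_into_inv_limit)
    show "tent (d n) (\<sigma> x (Suc n)) = \<sigma> x n" if "x \<in> topspace (tg_topology K)" for x n
      using U_step(1) \<sigma>U that by (simp add: topspace_tg_topology)
    show "continuous_map (tg_topology K) unit_interval (\<lambda>x. \<sigma> x n)" for n
      unfolding continuous_map_def topspace_tg_topology
    proof (intro conjI allI impI)
      show "(\<lambda>x. \<sigma> x n) \<in> ?C \<rightarrow> topspace unit_interval"
        using U_step(2) \<sigma>U by auto
      fix W assume W: "openin unit_interval W"
      show "openin (tg_topology K) {x \<in> ?C. \<sigma> x n \<in> W}"
      proof (subst openin_subopen, intro ballI)
        fix x assume "x \<in> {x \<in> ?C. \<sigma> x n \<in> W}"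
        then have x: "x \<in> ?C" "\<sigma> x n \<in> W" by auto
        obtain r where r: "r > 0" "ball (\<sigma> x n) r \<inter> {0..1} \<subseteq> W"
          using W x(2) openin_contains_ball by metis
        \<comment> \<open>\<open>\<sigma>\<close> varies by at most \<open>2 / 2 ^ k\<close> in the coordinate \<open>n\<close> where the interval at \<open>n + k\<close> is constant\<close>
        obtain k where k: "(1 / 2) ^ k < r / 2"
          using real_arch_pow_inv[of "r / 2" "1 / 2"] r(1) by auto
        let ?m = "n + k"
        let ?T = "{x' \<in> ?C. x' (N ?m) \<in> {x (N ?m)}}"
        have "openin (tg_topology K) ?T"
          using openin_continuous_map_preimage[OF continuous_map_tg_coord[of K "N ?m"], of "{x (N ?m)}"]
            tg_carrier_less[OF x(1)] by (simp add: topspace_tg_topology)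
        moreover have "?T \<subseteq> {x \<in> ?C. \<sigma> x n \<in> W}"
        proof
          fix x' assume "x' \<in> ?T"
          then have x': "x' \<in> ?C" "y ?m x' = y ?m x" by (auto simp: y_def)
          have "\<bar>\<sigma> x ?m - \<sigma> x' ?m\<bar> \<le> 2 / b ?m"
            using cell_dist[OF \<sigma>[OF x(1)] \<sigma>[OF x'(1)], of ?m] x'(2) by simp
          then have "\<bar>\<sigma> x n - \<sigma> x' n\<bar> \<le> 2 / 2 ^ (?m - n)"
            by (intro tent_limit_contraction[of b d, OF b1 bd]) (use \<sigma>U x x' in auto)
          then have "\<bar>\<sigma> x n - \<sigma> x' n\<bar> < r" using k by (simp add: power_one_over)
          then show "x' \<in> {x \<in> ?C. \<sigma> x n \<in> W}"
            using r(2) U_step(2)[OF \<sigma>U[OF x'(1)], of n] x'(1) by (auto simp: dist_real_def)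
        qed
        ultimately show "\<exists>T. openin (tg_topology K) T \<and> x \<in> T \<and> T \<subseteq> {x \<in> ?C. \<sigma> x n \<in> W}"
          using x(1) by (intro exI[of _ ?T]) auto
      qed
    qed
  qed

  moreover have ker: "(x, x') \<in> tg_rel K \<longleftrightarrow> \<sigma> x = \<sigma> x'" if x: "x \<in> ?C" "x' \<in> ?C" for x x'
  proof
    assume R: "(x, x') \<in> tg_rel K"
    have "\<bar>\<sigma> x j - \<sigma> x' j\<bar> \<le> 2 / b j" for j
    proof -
      have "(y j x, y j x') \<in> lg_edges (b j)"
        unfolding y_def by (rule lg_morphism_edge[OF h]) (use R in \<open>auto simp: tg_rel_def\<close>)
      then show ?thesis
        using cell_dist[OF \<sigma>[OF x(1)] \<sigma>[OF x(2)]] by (simp add: lg_edges_iff)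
    qed
    then show "\<sigma> x = \<sigma> x'"
      using tent_limit_eqI[of b d, OF b1 bd \<sigma>U[OF x(1)] \<sigma>U[OF x(2)]] by blast
  next
    assume eq: "\<sigma> x = \<sigma> x'"
    have "(y j x, y j x') \<in> lg_edges (b j)" for j
      using cells_meet[of "\<sigma> x j"] \<sigma>[OF x(1), of j] \<sigma>[OF x(2), of j] b1[of j] y_less x eq
      by (simp add: lg_edges_iff)
    then have "(e j (y (Suc j) x), e j (y (Suc j) x')) \<in> lg_edges (fst K (N j))" for j
      using lg_morphism_edge[OF e] by blast
    then have edge: "(x (N j), x' (N j)) \<in> lg_edges (fst K (N j))" for j
      using eh x by (simp add: y_def)
    have "(x n, x' n) \<in> lg_edges (fst K n)" for n
    proof -
      obtain i where i: "N n = n + i"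
        using strict_mono_imp_increasing[OF N, of n] le_Suc_ex by blast
      obtain f where "lg_morphism (fst K (n + i)) (fst K n) f" "\<forall>x\<in>?C. f (x (n + i)) = x n"
        using tg_bonding_composite[OF obj] by blast
      then show ?thesis using lg_morphism_edge[of _ _ f] edge[of n] x by (metis i)
    qed
    then show "(x, x') \<in> tg_rel K" using x by (simp add: tg_rel_def)
  qed

  moreover have "\<sigma> ` ?C = topspace ?U"
  proof
    show "\<sigma> ` ?C \<subseteq> topspace ?U" using \<sigma>U by blast
    show "topspace ?U \<subseteq> \<sigma> ` ?C"
    proof
      fix u assume u: "u \<in> topspace ?U"
      define F where "F j = {x \<in> topspace (tg_topology K). x (N j) \<in> {a. a < fst K (N j) \<and> u j \<in> cell (b j) (h j a)}}" for j
      have F: "x \<in> F j \<longleftrightarrow> x \<in> ?C \<and> u j \<in> cell (b j) (y j x)" for x j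
        using tg_carrier_less[of x K "N j"] by (auto simp: F_def y_def topspace_tg_topology)
      obtain x where "x \<in> topspace (tg_topology K)" "\<And>j. x \<in> F j"
      proof (rule compact_space_nested_closed[OF compact_space_tg_topology[OF obj]])
        show "closedin (tg_topology K) (F j)" for j
          unfolding F_def
          by (rule closedin_continuous_map_preimage[OF continuous_map_tg_coord]) auto
        show "F j \<noteq> {}" for j
        proof -
          obtain v where v: "v < b j" "u j \<in> cell (b j) v"
            using cells_cover[OF U_step(2)[OF u] b1] by blast
          have "v \<in> h j ` {..<fst K (N j)}"
            using lg_morphism_verts[OF h[of j]] v(1) by simp
          then obtain a where "a < fst K (N j)" "h j a = v"
            by auto
          then obtain x where "x \<in> ?C" "h j (x (N j)) = v"
            using tg_coord_surj[OF obj] by metis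
          then show ?thesis using F v by (auto simp: y_def)
        qed
        show "F (Suc j) \<subseteq> F j" for j
          using y_tent[of _ "u (Suc j)" j] U_step(1)[OF u, of j] by (auto simp: F)
      qed blast
      then have x: "x \<in> ?C" "\<And>j. u j \<in> cell (b j) (y j x)" by (auto simp: F)
      have "\<sigma> x = u"
        by (rule tent_limit_eqI[of b d, OF b1 bd \<sigma>U[OF x(1)] u])
          (rule cell_dist[OF \<sigma>[OF x(1)] x(2)], auto)
      then show "u \<in> \<sigma> ` ?C" using x(1) by blast
    qed
  qed

  moreover have eqv: "equiv ?C (tg_rel K)"
  proof (rule equivI)
    show sub: "tg_rel K \<subseteq> ?C \<times> ?C" by (auto simp: tg_rel_def)
    then have rel: "tg_rel K = {(x, x') \<in> ?C \<times> ?C. \<sigma> x = \<sigma> x'}" using ker by blast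
    show "refl_on ?C (tg_rel K)" "sym (tg_rel K)" "trans (tg_rel K)"
      unfolding rel by (auto simp: refl_on_def sym_def trans_def)
  qed

  ultimately have "quotient_space (tg_topology K) (tg_rel K) homeomorphic_space ?U"
    by (intro quotient_space_homeomorphic[of _ _ \<sigma>])
      (auto simp: topspace_tg_topology compact_space_tg_topology obj Hausdorff_space_tent_limit)
  then show ?thesis
    using eqv universal_Knaster_continuum_tent_limit[OF d] by blast
qed

end
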